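(* Let $T>0$ and let $W$ be a one-dimensional Brownian motion on $(\Omega,\mathscr F,\{\mathscr F_t\},\mathbb P)$, where $\{\mathscr F_t\}$ is the augmentation under $\mathbb P$ of the natural filtration of $W$. If $K\in\mathbb R$ is fixed but arbitrary and $p(t,x)=\frac1{\sqrt{2\pi t}}e^{-x^2/(2t)}$, then $$\mathbb I_{[K,\infty)}(W_T)=\mathbb P[W_T>K]+\int_0^Tp(T-s,W_s-K)\,dW_s\quad\text{a.s. }\mathbb P.$$
   Context: $\mathbb I_{[K,\infty)}$ is the indicator function of $[K,\infty)$; the integral is an Itô integral. The Brownian motion starts at a deterministic point. *)

theory Defs
  imports "HOL-Probability.Probability" "HOL-Probability.Stopping_Time"
begin

text \<open>Processes and filtrations are indexed by all of \<^typ>\<open>real\<close>, but only times \<open>t \<ge> 0\<close>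
  matter.\<close>

definition natural_events :: "'a measure \<Rightarrow> (real \<Rightarrow> 'a \<Rightarrow> real) \<Rightarrow> real set \<Rightarrow> 'a set set" where
  "natural_events M W S = {W s -` B \<inter> space M | s B. s \<in> S \<and> B \<in> sets borel}"

text \<open>The null sets adjoined are all subsets of null events of the sigma-algebra generated by the
  whole process \<open>(W\<^sub>s)\<^sub>s\<^sub>\<ge>\<^sub>0\<close>; they are not required to lie in \<open>M\<close> here.\<close>

definition augmentation_null_sets :: "'a measure \<Rightarrow> (real \<Rightarrow> 'a \<Rightarrow> real) \<Rightarrow> 'a set set" where
  "augmentation_null_sets M W =
     {A. \<exists>B \<in> sigma_sets (space M) (natural_events M W {0..}). emeasure M B = 0 \<and> A \<subseteq> B}"

definition augmented_filtration :: "'a measure \<Rightarrow> (real \<Rightarrow> 'a \<Rightarrow> real) \<Rightarrow> real \<Rightarrow> 'a measure" where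
  "augmented_filtration M W t =
     sigma (space M) (natural_events M W {0..t} \<union> augmentation_null_sets M W)"

locale brownian_motion = prob_space M + filtration "space M" F
  for M :: "'a measure" and F :: "real \<Rightarrow> 'a measure" +
  fixes W :: "real \<Rightarrow> 'a \<Rightarrow> real" and w0 :: real
  assumes filtration_subalgebra: "\<And>t. 0 \<le> t \<Longrightarrow> subalgebra M (F t)"
    and adapted: "\<And>t. 0 \<le> t \<Longrightarrow> W t \<in> borel_measurable (F t)"
    and continuous_paths: "\<And>\<omega>. \<omega> \<in> space M \<Longrightarrow> continuous_on {0..} (\<lambda>t. W t \<omega>)"
    and start: "AE \<omega> in M. W 0 \<omega> = w0"
    and independent_increments: "\<And>s t. 0 \<le> s \<Longrightarrow> s < t \<Longrightarrow>
      indep_set (sets (F s)) (sets (vimage_algebra (space M) (\<lambda>\<omega>. W t \<omega> - W s \<omega>) borel))"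
    and normal_increments: "\<And>s t. 0 \<le> s \<Longrightarrow> s < t \<Longrightarrow>
      distributed M lborel (\<lambda>\<omega>. W t \<omega> - W s \<omega>) (normal_density 0 (sqrt (t - s)))"

text \<open>Simple processes \<open>\<Sum>i<n. \<xi>\<^sub>i 1\<^bsub>(t\<^sub>i, t\<^sub>i\<^sub>+\<^sub>1]\<^esub>\<close> on a partition \<open>0 = t\<^sub>0 < \<dots> < t\<^sub>n = T\<close>, given by
  the data \<open>n\<close>, \<open>t\<close> and \<open>\<xi>\<close>.\<close>

definition simple_process_data ::
  "'a measure \<Rightarrow> (real \<Rightarrow> 'a measure) \<Rightarrow> real \<Rightarrow> nat \<Rightarrow> (nat \<Rightarrow> real) \<Rightarrow> (nat \<Rightarrow> 'a \<Rightarrow> real) \<Rightarrow> bool" where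
  "simple_process_data M F T n t \<xi> \<longleftrightarrow>
     t 0 = 0 \<and> t n = T \<and> (\<forall>i<n. t i < t (Suc i)) \<and>
     (\<forall>i<n. \<xi> i \<in> borel_measurable (F (t i))) \<and>
     (\<exists>C. \<forall>i<n. \<forall>\<omega>\<in>space M. \<bar>\<xi> i \<omega>\<bar> \<le> C)"

definition simple_process ::
  "nat \<Rightarrow> (nat \<Rightarrow> real) \<Rightarrow> (nat \<Rightarrow> 'a \<Rightarrow> real) \<Rightarrow> real \<Rightarrow> 'a \<Rightarrow> real" where
  "simple_process n t \<xi> s \<omega> = (\<Sum>i<n. \<xi> i \<omega> * indicator {t i<..t (Suc i)} s)"

definition simple_ito_integral ::
  "(real \<Rightarrow> 'a \<Rightarrow> real) \<Rightarrow> nat \<Rightarrow> (nat \<Rightarrow> real) \<Rightarrow> (nat \<Rightarrow> 'a \<Rightarrow> real) \<Rightarrow> 'a \<Rightarrow> real" where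
  "simple_ito_integral W n t \<xi> \<omega> = (\<Sum>i<n. \<xi> i \<omega> * (W (t (Suc i)) \<omega> - W (t i) \<omega>))"

definition progressively_measurable_upto ::
  "(real \<Rightarrow> 'a measure) \<Rightarrow> real \<Rightarrow> (real \<Rightarrow> 'a \<Rightarrow> real) \<Rightarrow> bool" where
  "progressively_measurable_upto F T H \<longleftrightarrow>
     (\<forall>t\<in>{0..T}. (\<lambda>(s, \<omega>). H s \<omega>) \<in> borel_measurable (restrict_space borel {0..t} \<Otimes>\<^sub>M F t))"

definition process_sq_norm :: "'a measure \<Rightarrow> real \<Rightarrow> (real \<Rightarrow> 'a \<Rightarrow> real) \<Rightarrow> ennreal" where
  "process_sq_norm M T H = (\<integral>\<^sup>+\<omega>. (\<integral>\<^sup>+s\<in>{0..T}. ennreal ((H s \<omega>)\<^sup>2) \<partial>lborel) \<partial>M)"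

text \<open>\<open>I\<close> is (a version of) the Ito integral of the progressively measurable, square-integrable
  process \<open>H\<close>: the \<open>L\<^sup>2\<close>-limit of the integrals of simple processes approximating \<open>H\<close>.\<close>

definition has_ito_integral ::
  "'a measure \<Rightarrow> (real \<Rightarrow> 'a measure) \<Rightarrow> (real \<Rightarrow> 'a \<Rightarrow> real) \<Rightarrow> real \<Rightarrow>
   (real \<Rightarrow> 'a \<Rightarrow> real) \<Rightarrow> ('a \<Rightarrow> real) \<Rightarrow> bool" where
  "has_ito_integral M F W T H I \<longleftrightarrow>
     progressively_measurable_upto F T H \<and> process_sq_norm M T H < \<infinity> \<and>
     I \<in> borel_measurable M \<and>
     (\<exists>n t \<xi>. (\<forall>k. simple_process_data M F T (n k) (t k) (\<xi> k)) \<and>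
        (\<lambda>k. process_sq_norm M T (\<lambda>s \<omega>. simple_process (n k) (t k) (\<xi> k) s \<omega> - H s \<omega>)) \<longlonglongrightarrow> 0 \<and>
        (\<lambda>k. \<integral>\<^sup>+\<omega>. ennreal ((simple_ito_integral W (n k) (t k) (\<xi> k) \<omega> - I \<omega>)\<^sup>2) \<partial>M) \<longlonglongrightarrow> 0)"

text \<open>The integral is determined up to almost sure equality, so a version is chosen; as with
  the library integrals, non-integrable processes get the value 0.\<close>

definition ito_integral ::
  "'a measure \<Rightarrow> (real \<Rightarrow> 'a measure) \<Rightarrow> (real \<Rightarrow> 'a \<Rightarrow> real) \<Rightarrow> real \<Rightarrow>
   (real \<Rightarrow> 'a \<Rightarrow> real) \<Rightarrow> 'a \<Rightarrow> real" where
  "ito_integral M F W T H =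
     (if \<exists>I. has_ito_integral M F W T H I then SOME I. has_ito_integral M F W T H I else (\<lambda>_. 0))"

text \<open>Used for \<open>t > 0\<close>; at \<open>t = 0\<close> division by zero makes it 0, which affects \<open>p(T - s, W\<^sub>s - K)\<close>
  only at the single time \<open>s = T\<close>.\<close>

definition gauss_kernel :: "real \<Rightarrow> real \<Rightarrow> real" where
  "gauss_kernel t x = 1 / sqrt (2 * pi * t) * exp (- x\<^sup>2 / (2 * t))"

end

theory Submission
  imports Defs
begin

text \<open>Write \<open>X = 1{W\<^sub>T \<ge> K} - P(W\<^sub>T > K)\<close>, \<open>H\<^sub>s = p(T - s, W\<^sub>s - K)\<close>, and \<open>\<parallel>\<phi>\<parallel>\<^sup>2\<close> for the expectation
  of the integral of \<open>\<phi>\<^sup>2\<close> over \<open>[0, T]\<close>, with \<open>\<langle>\<phi>, \<psi>\<rangle>\<close> the corresponding inner product. The proof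
  rests on one exact identity: for \<^emph>\<open>every\<close> simple process \<open>\<phi>\<close> with elementary
  stochastic integral \<open>S\<close>,
  \<open>E (S - X)\<^sup>2 = \<parallel>\<phi> - H\<parallel>\<^sup>2\<close> (\<open>simple_ito_error_eq\<close>).
  So simple integrals converge to \<open>X\<close> in \<open>L\<^sup>2\<close> as soon as their integrands converge to \<open>H\<close>, which
  shows both that \<open>X\<close> is a version of the Ito integral of \<open>H\<close> and that every version equals \<open>X\<close>
  almost surely.

  Expanding both squares reduces the identity to three equations.

  \<^item> \<open>E S\<^sup>2 = \<parallel>\<phi>\<parallel>\<^sup>2\<close> is the Ito isometry (\<open>simple_ito_isometry\<close>).

  \<^item> \<open>E (S X) = \<langle>\<phi>, H\<rangle>\<close>: for \<open>\<xi>\<close> known at time \<open>s\<close>, Gaussian integration by parts gives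
    \<open>E (\<xi> (W\<^sub>t - W\<^sub>s) 1{W\<^sub>T \<ge> K}) = (t - s) E (\<xi> H\<^sub>s)\<close>
    (\<open>expectation_increment_terminal_indicator\<close>). Since \<open>H\<close> is a martingale
    (\<open>kernel_martingale\<close>), the right-hand side is also the integral of \<open>E (\<xi> H\<^sub>r)\<close> over
    \<open>r \<in> [s, t]\<close>.

  \<^item> \<open>E X\<^sup>2 = \<parallel>H\<parallel>\<^sup>2\<close>: the left-hand side is \<open>\<Phi> (1 - \<Phi>)\<close> for a value \<open>\<Phi>\<close> of the normal distribution
    function, while \<open>E H\<^sub>s\<^sup>2\<close> is explicit, and a substitution turns its integral into one whose
    derivative in the parameter \<open>K\<close> can be computed
    (\<open>owen_integral_eq_gauss_cdf\<close>, \<open>nn_integral_kernel_energy\<close>).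

  It remains to approximate \<open>H\<close>. Sampling \<open>H\<close> at the left end points of a uniform partition
  gives simple processes for which \<open>\<langle>\<phi>, H\<rangle> = \<parallel>\<phi>\<parallel>\<^sup>2\<close>, again by the martingale property. Hence
  \<open>\<parallel>\<phi> - H\<parallel>\<^sup>2 = \<parallel>H\<parallel>\<^sup>2 - \<parallel>\<phi>\<parallel>\<^sup>2\<close> is the error of a left Riemann sum of the increasing function
  \<open>s \<mapsto> E H\<^sub>s\<^sup>2\<close>, and it tends to 0 although this function is unbounded at \<open>T\<close>
  (\<open>kernel_left_sampling\<close>).\<close>

section \<open>The heat kernel\<close>

lemma gauss_kernel_eq_normal_density:
  "t > 0 \<Longrightarrow> gauss_kernel t x = normal_density 0 (sqrt t) x"
  by (simp add: gauss_kernel_def normal_density_def)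

lemma gauss_kernel_nonneg [simp]: "0 \<le> t \<Longrightarrow> 0 \<le> gauss_kernel t x"
  by (simp add: gauss_kernel_def)

lemma gauss_kernel_minus [simp]: "gauss_kernel t (- x) = gauss_kernel t x"
  by (simp add: gauss_kernel_def)

lemma gauss_kernel_diff_commute: "gauss_kernel t (x - y) = gauss_kernel t (y - x)"
  using gauss_kernel_minus[of t "x - y"] by simp

lemma borel_measurable_gauss_kernel [measurable]:
  assumes [measurable]: "f \<in> borel_measurable N" "g \<in> borel_measurable N"
  shows "(\<lambda>x. gauss_kernel (f x) (g x)) \<in> borel_measurable N"
  unfolding gauss_kernel_def by measurable

lemma gauss_kernel_le:
  assumes "t > 0" shows "gauss_kernel t x \<le> 1 / sqrt (2 * pi * t)"
proof -
  have "1 / sqrt (2 * pi * t) * exp (- x\<^sup>2 / (2 * t)) \<le> 1 / sqrt (2 * pi * t) * 1"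
    using assms by (intro mult_left_mono) auto
  then show ?thesis by (simp add: gauss_kernel_def)
qed

lemma gauss_kernel_moments:
  assumes "t > 0"
  shows "has_bochner_integral lborel (\<lambda>x. gauss_kernel t x) 1"
    and "has_bochner_integral lborel (\<lambda>x. x * gauss_kernel t x) 0"
    and "has_bochner_integral lborel (\<lambda>x. x\<^sup>2 * gauss_kernel t x) t"
  using normal_moment_even[of "sqrt t" 0 0] normal_moment_odd[of "sqrt t" 0 0]
    normal_moment_even[of "sqrt t" 0 1] assms
  by (simp_all add: gauss_kernel_eq_normal_density mult.commute)

lemma gauss_kernel_convolution:
  assumes "s > 0" "t > 0"
  shows "has_bochner_integral lborel (\<lambda>y. gauss_kernel s (x - y) * gauss_kernel t y)
           (gauss_kernel (s + t) x)"
proof (rule has_bochner_integral_nn_integral)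
  show "(\<integral>\<^sup>+y. ennreal (gauss_kernel s (x - y) * gauss_kernel t y) \<partial>lborel)
      = ennreal (gauss_kernel (s + t) x)"
    using fun_cong[OF conv_normal_density_zero_mean[of "sqrt s" "sqrt t"], of x] assms
    by (simp add: gauss_kernel_eq_normal_density)
qed (use assms in auto)

text \<open>Squaring the kernel halves its variance up to a factor, so the second moment of the
  integrand is again a convolution of two kernels.\<close>

lemma gauss_kernel_square:
  assumes "t > 0"
  shows "(gauss_kernel t x)\<^sup>2 = gauss_kernel (t / 2) x / (2 * sqrt (pi * t))"
proof -
  have "(exp (- x\<^sup>2 / (2 * t)))\<^sup>2 = exp (- x\<^sup>2 / (2 * (t / 2)))"
    by (simp add: power2_eq_square flip: exp_add)
  moreover have "(1 / sqrt (2 * pi * t))\<^sup>2 = 1 / sqrt (2 * pi * (t / 2)) / (2 * sqrt (pi * t))"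
    using assms by (simp add: power_divide)
  ultimately show ?thesis
    unfolding gauss_kernel_def power_mult_distrib by simp
qed

lemma gauss_kernel_has_derivative:
  assumes "t > 0"
  shows "((\<lambda>x. - (t * gauss_kernel t x)) has_real_derivative x * gauss_kernel t x) (at x)"
  unfolding gauss_kernel_def using assms
  by (auto intro!: derivative_eq_intros simp: field_simps)

lemma gauss_kernel_tendsto_0:
  assumes "t > 0" shows "(gauss_kernel t \<longlongrightarrow> 0) at_top"
  unfolding gauss_kernel_def using assms by real_asymp

text \<open>This is Gaussian integration by parts against the indicator of a half-line: \<open>x p(t, x)\<close> is
  the derivative of \<open>- t p(t, x)\<close>. It is the only source of the integrand
  \<open>p(T - s, W\<^sub>s - K)\<close> in the final formula.\<close>

lemma gauss_kernel_truncated_moment: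
  assumes "t > 0"
  shows "has_bochner_integral lborel (\<lambda>x. x * gauss_kernel t x * indicator {c..} x)
           (t * gauss_kernel t c)"
proof -
  have int: "integrable lborel (\<lambda>x. x * gauss_kernel t x)"
    using gauss_kernel_moments(2)[OF assms] by (rule integrable.intros)
  have "set_integrable lborel {c<..} (\<lambda>x. x * gauss_kernel t x)"
    unfolding set_integrable_def using int by (intro integrable_mult_indicator) auto
  then have si: "set_integrable lborel (einterval c \<infinity>) (\<lambda>x. x * gauss_kernel t x)"
    by simp
  have "(LBINT x=ereal c..\<infinity>. x * gauss_kernel t x) = 0 - (- (t * gauss_kernel t c))"
  proof (rule interval_integral_FTC_integrable[where F = "\<lambda>x. - (t * gauss_kernel t x)"])
    show "((\<lambda>x. - (t * gauss_kernel t x)) has_vector_derivative x * gauss_kernel t x) (at x)" for x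
      using gauss_kernel_has_derivative[OF assms, of x]
      by (simp add: has_real_derivative_iff_has_vector_derivative)
    show "isCont (\<lambda>x. x * gauss_kernel t x) x" for x
      unfolding gauss_kernel_def using assms by (intro continuous_intros) auto
    show "set_integrable lborel (einterval c \<infinity>) (\<lambda>x. x * gauss_kernel t x)" by (rule si)
    have "((\<lambda>x. - (t * gauss_kernel t x)) \<longlongrightarrow> - (t * gauss_kernel t c)) (at_right c)"
      using DERIV_isCont[OF gauss_kernel_has_derivative[OF assms, of c]]
      by (simp add: isCont_def filterlim_at_split)
    then show "(((\<lambda>x. - (t * gauss_kernel t x)) \<circ> real_of_ereal) \<longlongrightarrow> - (t * gauss_kernel t c))
        (at_right (ereal c))"
      by (simp add: ereal_tendsto_simps)
    have "((\<lambda>x. - (t * gauss_kernel t x)) \<longlongrightarrow> - (t * 0)) at_top"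
      by (intro tendsto_intros gauss_kernel_tendsto_0 assms)
    then show "(((\<lambda>x. - (t * gauss_kernel t x)) \<circ> real_of_ereal) \<longlongrightarrow> 0) (at_left \<infinity>)"
      by (simp add: ereal_tendsto_simps)
  qed simp
  then have eq: "(LINT x:{c<..}|lborel. x * gauss_kernel t x) = t * gauss_kernel t c"
    by (simp add: interval_lebesgue_integral_def)
  have "has_bochner_integral lborel (\<lambda>x. x * gauss_kernel t x * indicator {c<..} x)
      (t * gauss_kernel t c)"
    using si eq unfolding has_bochner_integral_iff set_integrable_def set_lebesgue_integral_def
    by (simp add: mult.commute)
  moreover have "AE x in lborel. x * gauss_kernel t x * indicator {c<..} x
      = x * gauss_kernel t x * indicator {c..} x"
    using AE_lborel_singleton[of c] by eventually_elim (auto split: split_indicator)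
  ultimately show ?thesis
    by (subst has_bochner_integral_cong_AE[symmetric]) auto
qed

section \<open>Joint measurability of continuous processes\<close>

text \<open>A process with continuous paths is the pointwise limit of its samples at the times
  \<open>\<lfloor>s n\<rfloor> / n\<close>. These take countably many values, so that each sampled process is
  jointly measurable.\<close>

lemma borel_measurable_continuous_process:
  fixes X :: "real \<Rightarrow> 'a \<Rightarrow> real"
  assumes meas: "\<And>s. X s \<in> borel_measurable N"
    and cont: "\<And>\<omega>. \<omega> \<in> space N \<Longrightarrow> continuous_on UNIV (\<lambda>s. X s \<omega>)"
  shows "(\<lambda>(s, \<omega>). X s \<omega>) \<in> borel_measurable (borel \<Otimes>\<^sub>M N)"
proof -
  define X' where "X' n = (\<lambda>(s, \<omega>). X (of_int \<lfloor>s * real (Suc n)\<rfloor> / real (Suc n)) \<omega>)" for n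
  have "X' n \<in> borel_measurable (borel \<Otimes>\<^sub>M N)" for n
  proof -
    have "(\<lambda>z. X (of_int \<lfloor>fst z * real (Suc n)\<rfloor> / real (Suc n)) (snd z))
        \<in> borel_measurable (borel \<Otimes>\<^sub>M N)"
    proof (rule measurable_compose_countable[where
          f = "\<lambda>k z. X (of_int k / real (Suc n)) (snd z)" and g = "\<lambda>z. \<lfloor>fst z * real (Suc n)\<rfloor>"])
      show "(\<lambda>z. X (of_int k / real (Suc n)) (snd z)) \<in> borel_measurable (borel \<Otimes>\<^sub>M N)" for k :: int
        using meas by measurable
    qed measurable
    then show ?thesis by (simp add: X'_def split_beta')
  qed
  moreover have "(\<lambda>n. X' n z) \<longlonglongrightarrow> (case z of (s, \<omega>) \<Rightarrow> X s \<omega>)"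
    if "z \<in> space (borel \<Otimes>\<^sub>M N)" for z
  proof -
    obtain s \<omega> where z: "z = (s, \<omega>)" by force
    have "\<omega> \<in> space N" using that by (simp add: z space_pair_measure)
    have "(\<lambda>n. of_int \<lfloor>s * real (Suc n)\<rfloor> / real (Suc n)) \<longlonglongrightarrow> s"
    proof (rule tendsto_sandwich)
      show "(\<lambda>n. s - 1 / real (Suc n)) \<longlonglongrightarrow> s" by real_asymp
      show "\<forall>\<^sub>F n in sequentially. s - 1 / real (Suc n) \<le> of_int \<lfloor>s * real (Suc n)\<rfloor> / real (Suc n)"
      proof (rule always_eventually, rule allI)
        fix n
        have "(s * real (Suc n) - 1) / real (Suc n) \<le> of_int \<lfloor>s * real (Suc n)\<rfloor> / real (Suc n)"
          by (intro divide_right_mono) linarith+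
        then show "s - 1 / real (Suc n) \<le> of_int \<lfloor>s * real (Suc n)\<rfloor> / real (Suc n)"
          by (simp add: diff_divide_distrib)
      qed
      show "\<forall>\<^sub>F n in sequentially. of_int \<lfloor>s * real (Suc n)\<rfloor> / real (Suc n) \<le> s"
        by (intro always_eventually allI) (simp add: divide_le_eq)
    qed simp
    from continuous_on_tendsto_compose[OF cont[OF \<open>\<omega> \<in> space N\<close>] this] show ?thesis
      by (simp add: X'_def z)
  qed
  ultimately show ?thesis
    by (rule borel_measurable_LIMSEQ_metric)
qed

section \<open>Left Riemann sums of monotone functions\<close>

lemma partition_mono:
  fixes t :: "nat \<Rightarrow> real"
  assumes "\<And>i. i < n \<Longrightarrow> t i < t (Suc i)" "i \<le> j" "j \<le> n"
  shows "t i \<le> t j"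
  using assms(2,3)
proof (induction j rule: dec_induct)
  case (step k) then show ?case using assms(1)[of k] by simp
qed simp

lemma sum_partition_indicator:
  fixes t :: "nat \<Rightarrow> real"
  assumes t: "\<And>i. i < n \<Longrightarrow> t i < t (Suc i)" and i: "i < n" "t i < s" "s \<le> t (Suc i)"
  shows "(\<Sum>j<n. x j * indicator {t j<..t (Suc j)} s) = (x i :: real)"
proof -
  have "x j * indicator {t j<..t (Suc j)} s = (if j = i then x i else 0)" if "j < n" for j
  proof -
    consider "j = i" | "Suc j \<le> i" | "Suc i \<le> j" by linarith
    then show ?thesis
    proof cases
      case 2
      then have "t (Suc j) \<le> t i" using t i by (intro partition_mono[of n]) auto
      then show ?thesis using i 2 by auto
    next
      case 3
      then have "t (Suc i) \<le> t j" using t that by (intro partition_mono[of n]) auto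
      then show ?thesis using i 3 by auto
    qed (use i in auto)
  qed
  then have "(\<Sum>j<n. x j * indicator {t j<..t (Suc j)} s) = (\<Sum>j<n. if j = i then x i else 0)"
    by (intro sum.cong) auto
  then show ?thesis using i(1) by simp
qed

lemma uniform_partition_index:
  fixes s T :: real
  assumes "0 < T" "0 < s" "s \<le> T" "0 < n"
  obtains i where "i < n" "real i * T / real n < s" "s \<le> real (Suc i) * T / real n"
proof -
  define i where "i = nat (\<lceil>s * real n / T\<rceil> - 1)"
  have "0 < s * real n / T" "s * real n / T \<le> real n" using assms by (auto simp: divide_le_eq)
  then have "real i < s * real n / T" "s * real n / T \<le> real (Suc i)" "i < n"
    unfolding i_def by linarith+
  with that[of i] assms show thesis by (auto simp: field_simps)
qed

text \<open>The function may be unbounded near \<open>T\<close>. Monotonicity places the left step functions below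
  \<open>f\<close>, which therefore serves as the dominating function.\<close>

lemma left_riemann_sums_tendsto:
  fixes f :: "real \<Rightarrow> real"
  assumes T: "0 < T"
    and nonneg: "\<And>s. 0 \<le> s \<Longrightarrow> s < T \<Longrightarrow> 0 \<le> f s"
    and mono: "\<And>r s. 0 \<le> r \<Longrightarrow> r \<le> s \<Longrightarrow> s < T \<Longrightarrow> f r \<le> f s"
    and cont: "\<And>s. 0 < s \<Longrightarrow> s < T \<Longrightarrow> isCont f s"
    and int: "integrable lborel (\<lambda>s. indicator {0..T} s * f s)"
  shows "(\<lambda>n. \<Sum>i<n. f (real i * T / real n) * (T / real n))
    \<longlonglongrightarrow> (LBINT s. indicator {0..T} s * f s)"
proof -
  define t where "t n i = real i * T / real n" for n i :: nat
  define g where "g n s = (\<Sum>i<n. f (t n i) * indicator {t n i<..t n (Suc i)} s)" for n s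
  have t: "t n i < t n (Suc i)" if "i < n" for n i
    using that T by (simp add: t_def divide_strict_right_mono)
  have ends: "AE s in lborel. s \<noteq> 0 \<and> s \<noteq> T"
    using AE_lborel_singleton[of 0] AE_lborel_singleton[of T] by eventually_elim auto
  have outside: "g n s = 0" if "s < 0 \<or> T < s" for n s
    unfolding g_def
  proof (rule sum.neutral, rule ballI)
    fix i assume "i \<in> {..<n}"
    then have "t n 0 \<le> t n i" "t n (Suc i) \<le> t n n" using t[of _ n]
      by (intro partition_mono[of n]; auto)+
    then have "0 \<le> t n i" "t n (Suc i) \<le> T" using \<open>i \<in> {..<n}\<close> by (auto simp: t_def)
    then show "f (t n i) * indicator {t n i<..t n (Suc i)} s = 0" using that by auto
  qed
  \<comment> \<open>The partition interval containing \<open>s\<close> starts less than one mesh width before \<open>s\<close>.\<close>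
  have lower: "f (s - T / real n) \<le> g n s"
    if s: "0 < s" "s < T" "0 < n" "T / real n \<le> s" for n s
  proof -
    from s T obtain i where i: "i < n" "t n i < s" "s \<le> t n (Suc i)"
      unfolding t_def by (elim uniform_partition_index[of T s n]) auto
    have "g n s = f (t n i)" unfolding g_def using t[of _ n] i by (rule sum_partition_indicator)
    moreover have "t n (Suc i) = t n i + T / real n" by (simp add: t_def add_divide_distrib ring_distribs)
    ultimately show ?thesis using mono[of "s - T / real n" "t n i"] i s by auto
  qed
  have upper: "0 \<le> g n s \<and> g n s \<le> f s" if s: "0 < s" "s < T" for n s
  proof (cases "n = 0")
    case True then show ?thesis using s nonneg by (simp add: g_def)
  next
    case False
    with s T obtain i where i: "i < n" "t n i < s" "s \<le> t n (Suc i)"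
      unfolding t_def by (elim uniform_partition_index[of T s n]) auto
    have "g n s = f (t n i)" unfolding g_def using t[of _ n] i by (rule sum_partition_indicator)
    moreover have "0 \<le> t n i" using T by (simp add: t_def)
    ultimately show ?thesis using mono[of "t n i" s] i s nonneg[of "t n i"] by auto
  qed
  have "(\<lambda>n. LBINT s. g n s) \<longlonglongrightarrow> (LBINT s. indicator {0..T} s * f s)"
  proof (rule integral_dominated_convergence[where w = "\<lambda>s. indicator {0..T} s * f s"])
    show "(\<lambda>s. indicator {0..T} s * f s) \<in> borel_measurable lborel" using int by auto
    show "g n \<in> borel_measurable lborel" for n unfolding g_def by measurable
    show "AE s in lborel. (\<lambda>n. g n s) \<longlonglongrightarrow> indicator {0..T} s * f s"
      using ends
    proof eventually_elim
      fix s assume s: "s \<noteq> 0 \<and> s \<noteq> T"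
      show "(\<lambda>n. g n s) \<longlonglongrightarrow> indicator {0..T} s * f s"
      proof (cases "0 < s \<and> s < T")
        case True
        have "\<forall>\<^sub>F n in sequentially. T / real n \<le> s" using True T by real_asymp
        then have ev: "\<forall>\<^sub>F n in sequentially. f (s - T / real n) \<le> g n s \<and> g n s \<le> f s"
          using eventually_gt_at_top[of 0] by eventually_elim (use lower upper True in blast)
        have "(\<lambda>n. s - T / real n) \<longlonglongrightarrow> s" by real_asymp
        then have "(\<lambda>n. f (s - T / real n)) \<longlonglongrightarrow> f s"
          using cont True by (intro isCont_tendsto_compose[of s f]) auto
        then have "(\<lambda>n. g n s) \<longlonglongrightarrow> f s"
          by (rule tendsto_sandwich[rotated 2, OF _ tendsto_const])
             (use ev in \<open>auto elim: eventually_mono\<close>)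
        then show ?thesis using True by simp
      next
        case False
        then show ?thesis using s outside[of s] by (auto simp: indicator_def)
      qed
    qed
    show "AE s in lborel. norm (g n s) \<le> indicator {0..T} s * f s" for n
      using ends
    proof eventually_elim
      fix s assume "s \<noteq> 0 \<and> s \<noteq> T"
      then show "norm (g n s) \<le> indicator {0..T} s * f s"
        using upper[of s n] outside[of s n] by (cases "0 < s \<and> s < T") (auto simp: indicator_def)
    qed
  qed (use int in auto)
  moreover have "(LBINT s. g n s) = (\<Sum>i<n. f (t n i) * (T / real n))" for n
  proof -
    have "(LBINT s. g n s) = (\<Sum>i<n. LBINT s. f (t n i) * indicator {t n i<..t n (Suc i)} s)"
      unfolding g_def using t[of _ n]
      by (intro Bochner_Integration.integral_sum integrable_mult_right integrable_real_indicator)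
         (auto simp: emeasure_lborel_Ioc less_imp_le)
    also have "\<dots> = (\<Sum>i<n. f (t n i) * (T / real n))"
    proof (rule sum.cong[OF refl])
      fix i assume "i \<in> {..<n}"
      then show "(LBINT s. f (t n i) * indicator {t n i<..t n (Suc i)} s) = f (t n i) * (T / real n)"
        using t[of i n] by (simp add: t_def add_divide_distrib ring_distribs)
    qed
    finally show ?thesis .
  qed
  ultimately show ?thesis by (simp add: t_def)
qed

section \<open>The energy of the kernel and the normal distribution function\<close>

definition gauss_cdf :: "real \<Rightarrow> real \<Rightarrow> real" where
  "gauss_cdf T c = (LBINT x. gauss_kernel T x * indicator {..c} x)"

lemma integrable_gauss_kernel: "t > 0 \<Longrightarrow> integrable lborel (gauss_kernel t)"
  using gauss_kernel_moments(1)[of t] by (auto simp: has_bochner_integral_iff)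

lemma integrable_gauss_kernel_indicator:
  "t > 0 \<Longrightarrow> A \<in> sets borel \<Longrightarrow> integrable lborel (\<lambda>x. gauss_kernel t x * indicator A x)"
  using integrable_gauss_kernel[of t] by (intro integrable_real_mult_indicator) auto

lemma gauss_cdf_0:
  assumes "T > 0" shows "gauss_cdf T 0 = 1 / 2"
proof -
  have "gauss_cdf T 0 = (LBINT x. gauss_kernel T x * indicator {0..} x)"
    unfolding gauss_cdf_def
    by (subst lborel_integral_real_affine[where c = "-1" and t = 0])
       (auto simp: indicator_def intro!: Bochner_Integration.integral_cong)
  moreover have "(LBINT x. gauss_kernel T x * indicator {0..} x) + gauss_cdf T 0
      = (LBINT x. gauss_kernel T x * indicator {0..} x + gauss_kernel T x * indicator {..0} x)"
    unfolding gauss_cdf_def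
    by (intro Bochner_Integration.integral_add[symmetric] integrable_gauss_kernel_indicator assms) auto
  moreover have "\<dots> = (LBINT x. gauss_kernel T x)"
    using AE_lborel_singleton[of 0] by (intro integral_cong_AE) (auto simp: indicator_def)
  moreover have "\<dots> = 1"
    using gauss_kernel_moments(1)[OF assms] by (simp add: has_bochner_integral_iff)
  ultimately show ?thesis by simp
qed

lemma isCont_gauss_kernel: "t > 0 \<Longrightarrow> isCont (gauss_kernel t) x"
  unfolding gauss_kernel_def by (intro continuous_intros) auto

text \<open>The continuous density has some antiderivative on the whole line, and on bounded intervals
  the distribution function has the same increments.\<close>

lemma gauss_cdf_has_derivative:
  assumes "T > 0"
  shows "(gauss_cdf T has_real_derivative gauss_kernel T c) (at c)"
proof -
  have "\<exists>\<Phi>. \<forall>x::real. (-\<infinity>::ereal) < x \<longrightarrow> x < (\<infinity>::ereal) \<longrightarrow>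
      (\<Phi> has_vector_derivative gauss_kernel T x) (at x)"
    using assms by (intro einterval_antiderivative isCont_gauss_kernel) auto
  then obtain \<Phi> where \<Phi>: "\<And>x. (\<Phi> has_real_derivative gauss_kernel T x) (at x)"
    by (auto simp: has_real_derivative_iff_has_vector_derivative)
  have diff: "gauss_cdf T b - gauss_cdf T a = \<Phi> b - \<Phi> a" if "a \<le> b" for a b
  proof -
    have "gauss_cdf T b - gauss_cdf T a
        = (LBINT x. gauss_kernel T x * indicator {..b} x - gauss_kernel T x * indicator {..a} x)"
      unfolding gauss_cdf_def
      by (intro Bochner_Integration.integral_diff[symmetric] integrable_gauss_kernel_indicator assms) auto
    also have "\<dots> = (LBINT x. gauss_kernel T x * indicator {a..b} x)"
      using AE_lborel_singleton[of a] that
      by (intro integral_cong_AE) (auto simp: indicator_def)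
    also have "\<dots> = \<Phi> b - \<Phi> a"
      using that \<Phi> isCont_gauss_kernel[OF assms]
      by (intro integral_FTC_Icc_real) auto
    finally show ?thesis .
  qed
  have "gauss_cdf T = (\<lambda>x. \<Phi> x + (gauss_cdf T 0 - \<Phi> 0))"
  proof
    fix x show "gauss_cdf T x = \<Phi> x + (gauss_cdf T 0 - \<Phi> 0)"
      using diff[of 0 x] diff[of x 0] by (cases "0 \<le> x") auto
  qed
  then show ?thesis by (rule ssubst) (use \<Phi> in \<open>auto intro!: derivative_eq_intros\<close>)
qed

text \<open>A special case of Owen's \<open>T\<close> function: the integral is \<open>2 T(c / \<surd>T, 1)\<close>. Differentiating
  under the integral sign in \<open>c\<close> cancels the denominator \<open>1 + w\<^sup>2\<close> and leaves a Gaussian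
  integral in \<open>w\<close>, so that the derivative is \<open>- 2 p(T, c) (\<Phi>(c) - 1/2)\<close>. This is
  also the derivative of \<open>1/4 - (\<Phi>(c) - 1/2)\<^sup>2 = \<Phi>(c) (1 - \<Phi>(c))\<close>, and at \<open>c = 0\<close> both sides are
  \<open>1/4\<close>.\<close>

lemma owen_integral_eq_gauss_cdf:
  assumes "T > 0"
  shows "integral {-1..0} (\<lambda>w. exp (- c\<^sup>2 * (1 + w\<^sup>2) / (2 * T)) / (pi * (1 + w\<^sup>2)))
    = gauss_cdf T c * (1 - gauss_cdf T c)"
proof -
  define g where "g c w = exp (- c\<^sup>2 * (1 + w\<^sup>2) / (2 * T)) / (pi * (1 + w\<^sup>2))" for c w
  define G where "G c = integral {-1..0} (g c)" for c
  have pos: "1 + w\<^sup>2 \<noteq> 0" for w :: real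
    using add_pos_nonneg[of 1 "w\<^sup>2"] by simp
  have G': "(G has_real_derivative - 2 * gauss_kernel T c * (gauss_cdf T c - 1/2)) (at c)" for c
  proof -
    have "((\<lambda>x. integral (cbox (-1) 0) (g x)) has_real_derivative
        integral (cbox (-1) 0) (\<lambda>w. - (c / (T * pi)) * exp (- c\<^sup>2 * (1 + w\<^sup>2) / (2 * T)))) (at c within UNIV)"
    proof (rule leibniz_rule_field_derivative[where
          fx = "\<lambda>c w. - (c / (T * pi)) * exp (- c\<^sup>2 * (1 + w\<^sup>2) / (2 * T))"])
      show "((\<lambda>x. g x w) has_real_derivative - (x / (T * pi)) * exp (- x\<^sup>2 * (1 + w\<^sup>2) / (2 * T)))
          (at x within UNIV)" for x w
      proof -
        have "((\<lambda>x. exp (- x\<^sup>2 * D / (2 * T)) / (pi * D)) has_real_derivative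
            - (x / (T * pi)) * exp (- x\<^sup>2 * D / (2 * T))) (at x)" if "D \<noteq> 0" for D
          using that assms by (auto intro!: derivative_eq_intros)
        from this[OF pos[of w]] show ?thesis by (simp add: g_def)
      qed
      show "g x integrable_on cbox (-1) 0" for x
        unfolding g_def using assms pos by (intro integrable_continuous continuous_intros) auto
      show "continuous_on (UNIV \<times> cbox (-1) 0)
          (\<lambda>(x, w). - (x / (T * pi)) * exp (- x\<^sup>2 * (1 + w\<^sup>2) / (2 * T)))"
        unfolding split_beta using assms by (intro continuous_intros) auto
    qed auto
    moreover have "((\<lambda>w. - (c / (T * pi)) * exp (- c\<^sup>2 * (1 + w\<^sup>2) / (2 * T))) has_integral
        - 2 * gauss_kernel T c * (gauss_cdf T c - 1/2)) {-1..0}"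
    proof -
      have "((\<lambda>w. c * gauss_kernel T (c * w)) has_integral
          - gauss_cdf T (- c * 0) - - gauss_cdf T (- c * (-1))) {-1..0}"
      proof (rule fundamental_theorem_of_calculus)
        show "((\<lambda>w. - gauss_cdf T (- c * w)) has_vector_derivative c * gauss_kernel T (c * w))
            (at w within {-1..0})" for w
        proof -
          have "((\<lambda>w. gauss_cdf T (- c * w)) has_real_derivative gauss_kernel T (- c * w) * (- c)) (at w)"
            by (rule DERIV_chain2[OF gauss_cdf_has_derivative[OF assms]])
               (auto intro!: derivative_eq_intros)
          from DERIV_minus[OF this] show ?thesis
            by (simp add: has_real_derivative_iff_has_vector_derivative[symmetric]
                has_field_derivative_at_within mult.commute)
        qed
      qed simp
      then have "((\<lambda>w. - 2 * gauss_kernel T c * (c * gauss_kernel T (c * w))) has_integral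
          - 2 * gauss_kernel T c * (gauss_cdf T c - 1/2)) {-1..0}"
        using gauss_cdf_0[OF assms] by (intro has_integral_mult_right) simp
      moreover have "- 2 * gauss_kernel T c * (c * gauss_kernel T (c * w))
          = - (c / (T * pi)) * exp (- c\<^sup>2 * (1 + w\<^sup>2) / (2 * T))" for w
      proof -
        have "exp (- c\<^sup>2 / (2 * T)) * exp (- (c * w)\<^sup>2 / (2 * T)) = exp (- c\<^sup>2 * (1 + w\<^sup>2) / (2 * T))"
          unfolding exp_add[symmetric]
          by (simp add: add_divide_distrib[symmetric] power_mult_distrib algebra_simps)
        moreover have "1 / sqrt (2 * pi * T) * (1 / sqrt (2 * pi * T)) = 1 / (2 * pi * T)"
          using assms by simp
        moreover have "gauss_kernel T c * gauss_kernel T (c * w)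
            = (1 / sqrt (2 * pi * T) * (1 / sqrt (2 * pi * T)))
              * (exp (- c\<^sup>2 / (2 * T)) * exp (- (c * w)\<^sup>2 / (2 * T)))"
          unfolding gauss_kernel_def by (simp only: mult_ac)
        ultimately have "gauss_kernel T c * gauss_kernel T (c * w)
            = 1 / (2 * pi * T) * exp (- c\<^sup>2 * (1 + w\<^sup>2) / (2 * T))"
          by simp
        moreover have "- 2 * gauss_kernel T c * (c * gauss_kernel T (c * w))
            = - 2 * c * (gauss_kernel T c * gauss_kernel T (c * w))"
          by (simp only: mult_ac)
        ultimately show ?thesis by simp
      qed
      ultimately show ?thesis by simp
    qed
    note integral_unique[OF this]
    ultimately show ?thesis unfolding G_def by (simp only: box_real)
  qed
  have "((\<lambda>c. G c + (gauss_cdf T c - 1/2)\<^sup>2) has_real_derivative 0) (at c)" for c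
    using gauss_cdf_has_derivative[OF assms, of c] G'[of c]
    by (auto intro!: derivative_eq_intros simp: algebra_simps)
  then have "G c + (gauss_cdf T c - 1/2)\<^sup>2 = G 0 + (gauss_cdf T 0 - 1/2)\<^sup>2"
    by (intro DERIV_isconst_all) auto
  moreover have "G 0 = 1 / 4"
  proof -
    have "((\<lambda>w. 1 / (1 + w\<^sup>2)) has_integral arctan 0 - arctan (-1)) {-1..0::real}"
      by (rule fundamental_theorem_of_calculus)
         (auto intro!: derivative_eq_intros simp: has_real_derivative_iff_has_vector_derivative[symmetric]
            inverse_eq_divide)
    from has_integral_mult_right[OF this, of "1 / pi"]
    have "((\<lambda>w. 1 / (pi * (1 + w\<^sup>2))) has_integral 1 / 4) {-1..0::real}"
      by (simp add: arctan_minus arctan_one)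
    moreover have "g 0 = (\<lambda>w. 1 / (pi * (1 + w\<^sup>2)))" by (auto simp: g_def)
    ultimately show ?thesis by (simp add: G_def integral_unique)
  qed
  ultimately have "G c = gauss_cdf T c * (1 - gauss_cdf T c)"
    using gauss_cdf_0[OF assms] by (simp add: power2_eq_square algebra_simps)
  moreover have "g c = (\<lambda>w. exp (- c\<^sup>2 * (1 + w\<^sup>2) / (2 * T)) / (pi * (1 + w\<^sup>2)))"
    by (simp add: g_def fun_eq_iff)
  ultimately show ?thesis by (simp only: G_def)
qed

text \<open>The second moment of \<open>p(T - s, W\<^sub>s - K)\<close> for a Brownian motion started at distance \<open>c\<close>
  from \<open>K\<close>, as \<open>expectation_kernel_square\<close> shows. At \<open>s = T\<close> the value is the default 0 of
  division by zero, although the limit is infinite when \<open>c = 0\<close>.\<close>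

definition kernel_energy :: "real \<Rightarrow> real \<Rightarrow> real \<Rightarrow> real" where
  "kernel_energy T c s = exp (- c\<^sup>2 / (T + s)) / (2 * pi * sqrt (T\<^sup>2 - s\<^sup>2))"

lemma borel_measurable_kernel_energy [measurable]: "kernel_energy T c \<in> borel_measurable borel"
  unfolding kernel_energy_def by measurable

lemma kernel_energy_nonneg:
  assumes "0 \<le> s" "s \<le> T" shows "0 \<le> kernel_energy T c s"
proof -
  have "s\<^sup>2 \<le> T\<^sup>2" using assms by (intro power_mono) auto
  then show ?thesis by (simp add: kernel_energy_def)
qed

lemma kernel_energy_mono:
  assumes "0 \<le> r" "r \<le> s" "s < T" shows "kernel_energy T c r \<le> kernel_energy T c s"
  unfolding kernel_energy_def
proof (rule frac_le)
  have "s\<^sup>2 < T\<^sup>2" "r\<^sup>2 \<le> s\<^sup>2" using assms by (auto intro!: power_strict_mono power_mono)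
  then show "0 < 2 * pi * sqrt (T\<^sup>2 - s\<^sup>2)" "2 * pi * sqrt (T\<^sup>2 - s\<^sup>2) \<le> 2 * pi * sqrt (T\<^sup>2 - r\<^sup>2)"
    by auto
  show "exp (- c\<^sup>2 / (T + r)) \<le> exp (- c\<^sup>2 / (T + s))"
    using assms by (auto intro!: divide_left_mono mult_pos_pos)
qed auto

lemma isCont_kernel_energy:
  assumes "0 < s" "s < T" shows "isCont (kernel_energy T c) s"
proof -
  have "s\<^sup>2 < T\<^sup>2" using assms by (intro power_strict_mono) auto
  then show ?thesis unfolding kernel_energy_def using assms by (intro continuous_intros) auto
qed

text \<open>The substitution \<open>s = T (1 - w\<^sup>2) / (1 + w\<^sup>2)\<close> rationalises \<open>\<surd>(T\<^sup>2 - s\<^sup>2)\<close> and removes the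
  singularity at \<open>s = T\<close>. The parameter \<open>w\<close> runs through \<open>[-1, 0]\<close> rather than \<open>[0, 1]\<close> so
  that \<open>s\<close> increases with \<open>w\<close>.\<close>

lemma nn_integral_kernel_energy:
  assumes T: "0 < T"
  shows "(\<integral>\<^sup>+s. ennreal (kernel_energy T c s) * indicator {0..T} s \<partial>lborel)
    = ennreal (gauss_cdf T c * (1 - gauss_cdf T c))"
proof -
  define g where "g w = T * (1 - w\<^sup>2) / (1 + w\<^sup>2)" for w :: real
  define g' where "g' w = - 4 * T * w / (1 + w\<^sup>2)\<^sup>2" for w :: real
  define h where "h w = exp (- c\<^sup>2 * (1 + w\<^sup>2) / (2 * T)) / (pi * (1 + w\<^sup>2))" for w :: real
  have pos: "0 < 1 + w\<^sup>2" for w :: real by (rule add_pos_nonneg) auto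
  have g: "g (-1) = 0" "g 0 = T" by (simp_all add: g_def)
  have "(\<integral>\<^sup>+s. ennreal (kernel_energy T c s * indicator {g (-1)..g 0} s) \<partial>lborel)
      = (\<integral>\<^sup>+w. ennreal (kernel_energy T c (g w) * g' w * indicator {-1..0} w) \<partial>lborel)"
  proof (rule nn_integral_substitution)
    show "set_borel_measurable borel {g (-1)..g 0} (kernel_energy T c)"
      unfolding set_borel_measurable_def by measurable
    show "(g has_real_derivative g' w) (at w)" for w
      unfolding g_def g'_def using pos[of w]
      by (auto intro!: derivative_eq_intros simp: field_simps power2_eq_square)
    show "continuous_on {-1..0} g'"
      unfolding g'_def using pos by (intro continuous_intros) (metis less_irrefl power_eq_0_iff)
    show "0 \<le> g' w" if "w \<in> {-1..0}" for w
      using that T pos[of w] unfolding g'_def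
      by (intro divide_nonneg_nonneg) (auto simp: mult_nonneg_nonpos)
  qed simp
  also have "\<dots> = (\<integral>\<^sup>+w. ennreal (h w * indicator {-1..0} w) \<partial>lborel)"
  proof (rule nn_integral_cong_AE)
    show "AE w in lborel. ennreal (kernel_energy T c (g w) * g' w * indicator {-1..0} w)
        = ennreal (h w * indicator {-1..0} w)"
      using AE_lborel_singleton[of 0]
    proof eventually_elim
      fix w :: real assume "w \<noteq> 0"
      have "kernel_energy T c (g w) * g' w = h w" if "w \<in> {-1..0}"
      proof -
        have w: "w < 0" using that \<open>w \<noteq> 0\<close> by simp
        define D where "D = 1 + w\<^sup>2"
        have D: "0 < D" using pos by (simp add: D_def)
        have 1: "T + g w = 2 * T / D"
          using D unfolding g_def by (simp add: D_def[symmetric] field_simps) (simp add: D_def algebra_simps)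
        have "T\<^sup>2 - (g w)\<^sup>2 = (2 * T * (- w) / D)\<^sup>2"
        proof -
          have "1 - ((1 - w\<^sup>2) / D)\<^sup>2 = (2 * (- w) / D)\<^sup>2"
            using D by (simp add: field_simps power2_eq_square) (simp add: D_def power2_eq_square algebra_simps)
          then have "T\<^sup>2 * (1 - ((1 - w\<^sup>2) / D)\<^sup>2) = T\<^sup>2 * (2 * (- w) / D)\<^sup>2" by simp
          moreover have "g w = T * ((1 - w\<^sup>2) / D)" "2 * T * (- w) / D = T * (2 * (- w) / D)"
            by (simp_all add: g_def D_def)
          ultimately show ?thesis by (simp only: power_mult_distrib[of T] right_diff_distrib mult_1_right)
        qed
        then have 2: "sqrt (T\<^sup>2 - (g w)\<^sup>2) = 2 * T * (- w) / D"
          using D T w by (simp add: real_sqrt_abs zero_less_mult_iff mult_le_0_iff)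
        have "kernel_energy T c (g w) * g' w
            = exp (- c\<^sup>2 / (2 * T / D)) / (2 * pi * (2 * T * (- w) / D)) * (- 4 * T * w / D\<^sup>2)"
          unfolding kernel_energy_def 1 2 g'_def D_def[symmetric] ..
        also have "\<dots> = exp (- c\<^sup>2 / (2 * T / D)) / (pi * D)"
          using D T w by (simp add: field_simps power2_eq_square)
        also have "\<dots> = h w" by (simp add: h_def D_def)
        finally show ?thesis .
      qed
      then show "ennreal (kernel_energy T c (g w) * g' w * indicator {-1..0} w)
          = ennreal (h w * indicator {-1..0} w)"
        by (auto simp: indicator_def)
    qed
  qed
  also have "\<dots> = ennreal (integral {-1..0} h)"
  proof -
    have "h integrable_on {-1..0}"
      unfolding h_def using T pos
      by (intro integrable_continuous_real continuous_intros) (auto simp: less_imp_neq[THEN not_sym])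
    then have "(h has_integral integral {-1..0} h) {-1..0}" by (rule integrable_integral)
    then have "(\<integral>\<^sup>+w. ennreal (h w) * indicator {-1..0} w \<partial>lborel) = ennreal (integral {-1..0} h)"
      by (rule nn_integral_has_integral_lebesgue'[rotated]) (use pos in \<open>simp add: h_def less_imp_le\<close>)
    then show ?thesis by (simp add: nn_integral_set_ennreal)
  qed
  also have "\<dots> = ennreal (gauss_cdf T c * (1 - gauss_cdf T c))"
    unfolding h_def using owen_integral_eq_gauss_cdf[OF T, of c] by simp
  finally show ?thesis unfolding g by (simp add: nn_integral_set_ennreal)
qed

section \<open>Independence of an increment from the past\<close>

context brownian_motion
begin

lemma space_filtration [simp]: "space (F t) = space M"
  by (rule space_F)

lemma measurable_filtration_mono:
  assumes "f \<in> borel_measurable (F s)" "s \<le> t"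
  shows "f \<in> borel_measurable (F t)"
  using measurable_mono[of borel borel "F s" "F t"] assms sets_F_mono[OF assms(2)] by auto

lemma measurable_filtration_M:
  assumes "f \<in> borel_measurable (F t)" "0 \<le> t"
  shows "f \<in> borel_measurable M"
  using measurable_from_subalg[OF filtration_subalgebra[OF assms(2)]] assms(1) by blast

lemma borel_measurable_W [measurable]: "0 \<le> t \<Longrightarrow> W t \<in> borel_measurable M"
  using adapted measurable_filtration_M by blast

text \<open>Clamping the time to \<open>[0, t]\<close> gives a process on the whole line that is continuous and
  measurable with respect to the past of \<open>t\<close>, without changing \<open>W\<close> on \<open>[0, t]\<close>. Progressive
  measurability and joint measurability on \<open>[0, T]\<close> both follow.\<close>

lemma borel_measurable_W_joint:
  assumes "0 \<le> t"
  shows "(\<lambda>(s, \<omega>). W (max 0 (min t s)) \<omega>) \<in> borel_measurable (borel \<Otimes>\<^sub>M F t)"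
proof (rule borel_measurable_continuous_process)
  show "W (max 0 (min t s)) \<in> borel_measurable (F t)" for s
    using assms by (intro measurable_filtration_mono[OF adapted]) auto
  show "continuous_on UNIV (\<lambda>s. W (max 0 (min t s)) \<omega>)" if "\<omega> \<in> space (F t)" for \<omega>
    using that continuous_paths[of \<omega>]
    by (auto intro!: continuous_on_compose2[of "{0..}" "\<lambda>t. W t \<omega>"] continuous_intros)
qed

lemma measurable_M_filtration: "0 \<le> s \<Longrightarrow> (\<lambda>x. x) \<in> measurable M (F s)"
  using filtration_subalgebra[of s]
  by (auto simp: measurable_def subalgebra_def)

text \<open>Independence is expressed with the identity map into the past \<open>F s\<close> itself as the first
  component. Every functional of the past, such as a coefficient \<open>\<xi>\<close> together with \<open>W s\<close>, is
  then covered without naming its random variables.\<close>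

lemma distr_past_increment:
  assumes "0 \<le> s" "s < t"
  shows "distr M (F s \<Otimes>\<^sub>M borel) (\<lambda>\<omega>. (\<omega>, W t \<omega> - W s \<omega>))
    = distr M (F s) (\<lambda>\<omega>. \<omega>) \<Otimes>\<^sub>M density lborel (\<lambda>x. ennreal (gauss_kernel (t - s) x))"
proof -
  let ?A = "\<lambda>\<omega>. W t \<omega> - W s \<omega>"
  have [measurable]: "?A \<in> borel_measurable M"
    using assms by (intro borel_measurable_diff borel_measurable_W) auto
  note [measurable] = measurable_M_filtration[OF assms(1)]
  have indep: "indep_set (sets (F s)) (sets (vimage_algebra (space M) ?A borel))"
    using assms by (rule independent_increments)
  have "distr M (F s) (\<lambda>\<omega>. \<omega>) \<Otimes>\<^sub>M distr M borel ?A = distr M (F s \<Otimes>\<^sub>M borel) (\<lambda>\<omega>. (\<omega>, ?A \<omega>))"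
  proof (rule pair_measure_eqI)
    show "sigma_finite_measure (distr M (F s) (\<lambda>\<omega>. \<omega>))" "sigma_finite_measure (distr M borel ?A)"
      by (intro finite_measure.axioms(1) finite_measure_distr; measurable)+
    show "sets (distr M (F s) (\<lambda>\<omega>. \<omega>) \<Otimes>\<^sub>M distr M borel ?A)
        = sets (distr M (F s \<Otimes>\<^sub>M borel) (\<lambda>\<omega>. (\<omega>, ?A \<omega>)))"
      by (simp cong: sets_pair_measure_cong)
    fix B C assume "B \<in> sets (distr M (F s) (\<lambda>\<omega>. \<omega>))" "C \<in> sets (distr M borel ?A)"
    then have [measurable]: "B \<in> sets (F s)" "C \<in> sets borel" by auto
    have B: "B \<subseteq> space M" using sets.sets_into_space[of B "F s"] by simp
    have "?A -` C \<inter> space M \<in> sets (vimage_algebra (space M) ?A borel)"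
      by (intro in_vimage_algebra) measurable
    from indep_setD[OF indep _ this, of B]
    have "prob (B \<inter> (?A -` C \<inter> space M)) = prob B * prob (?A -` C \<inter> space M)" by simp
    moreover have "(\<lambda>\<omega>. \<omega>) -` B \<inter> space M = B"
      "(\<lambda>\<omega>. (\<omega>, ?A \<omega>)) -` (B \<times> C) \<inter> space M = B \<inter> (?A -` C \<inter> space M)"
      using B by auto
    ultimately show "emeasure (distr M (F s) (\<lambda>\<omega>. \<omega>)) B * emeasure (distr M borel ?A) C
        = emeasure (distr M (F s \<Otimes>\<^sub>M borel) (\<lambda>\<omega>. (\<omega>, ?A \<omega>))) (B \<times> C)"
      by (simp add: emeasure_distr emeasure_eq_measure ennreal_mult'')
  qed
  also have "distr M borel ?A = distr M lborel ?A"
    by (rule distr_cong) auto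
  also have "\<dots> = density lborel (\<lambda>x. ennreal (gauss_kernel (t - s) x))"
    using normal_increments[OF assms] assms
    by (simp add: distributed_def gauss_kernel_eq_normal_density)
  finally show ?thesis by simp
qed

text \<open>This replaces conditioning on \<open>F s\<close>: the increment may be integrated out first, with its
  Gaussian density, while the dependence on the past is held fixed.\<close>

lemma expectation_increment:
  assumes st: "0 \<le> s" "s < t"
    and f[measurable]: "f \<in> borel_measurable (F s \<Otimes>\<^sub>M borel)"
    and int: "integrable M (\<lambda>\<omega>. f (\<omega>, W t \<omega> - W s \<omega>))"
  shows "expectation (\<lambda>\<omega>. f (\<omega>, W t \<omega> - W s \<omega>) :: real)
    = expectation (\<lambda>\<omega>. LBINT x. f (\<omega>, x) * gauss_kernel (t - s) x)"
proof -
  let ?A = "\<lambda>\<omega>. W t \<omega> - W s \<omega>"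
  let ?N = "density lborel (\<lambda>x. ennreal (gauss_kernel (t - s) x))"
  note [measurable] = measurable_M_filtration[OF st(1)]
  have [measurable]: "?A \<in> borel_measurable M"
    using st by (intro borel_measurable_diff borel_measurable_W) auto
  have P: "(\<lambda>\<omega>. (\<omega>, ?A \<omega>)) \<in> measurable M (F s \<Otimes>\<^sub>M borel)" by measurable
  interpret Q1: prob_space "distr M (F s) (\<lambda>\<omega>. \<omega>)" by (rule prob_space_distr) measurable
  interpret Q2: prob_space ?N
    using prob_space_normal_density[of "sqrt (t - s)" 0] st
    by (simp add: gauss_kernel_eq_normal_density)
  interpret Q: pair_prob_space "distr M (F s) (\<lambda>\<omega>. \<omega>)" ?N ..
  have "integrable (distr M (F s \<Otimes>\<^sub>M borel) (\<lambda>\<omega>. (\<omega>, ?A \<omega>))) f"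
    by (subst integrable_distr_eq[OF P]) (use int in auto)
  then have int': "integrable (distr M (F s) (\<lambda>\<omega>. \<omega>) \<Otimes>\<^sub>M ?N) f"
    unfolding distr_past_increment[OF st] .
  have "expectation (\<lambda>\<omega>. f (\<omega>, ?A \<omega>))
      = integral\<^sup>L (distr M (F s \<Otimes>\<^sub>M borel) (\<lambda>\<omega>. (\<omega>, ?A \<omega>))) f"
    by (subst integral_distr[OF P]) auto
  also have "\<dots> = (\<integral>\<omega>. (\<integral>x. f (\<omega>, x) \<partial>?N) \<partial>distr M (F s) (\<lambda>\<omega>. \<omega>))"
    unfolding distr_past_increment[OF st] using Q.integral_fst'[OF int'] by simp
  also have "\<dots> = expectation (\<lambda>\<omega>. \<integral>x. f (\<omega>, x) \<partial>?N)"
    by (rule integral_distr) measurable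
  also have "\<dots> = expectation (\<lambda>\<omega>. LBINT x. f (\<omega>, x) * gauss_kernel (t - s) x)"
  proof (rule Bochner_Integration.integral_cong[OF refl])
    fix \<omega> assume "\<omega> \<in> space M"
    then have [measurable]: "(\<lambda>x. f (\<omega>, x)) \<in> borel_measurable borel"
      by (intro measurable_compose[OF _ f] measurable_Pair1') simp
    show "(\<integral>x. f (\<omega>, x) \<partial>?N) = (LBINT x. f (\<omega>, x) * gauss_kernel (t - s) x)"
      using st by (subst integral_density) (auto simp: mult.commute)
  qed
  finally show ?thesis .
qed

end

section \<open>Expectations against an increment\<close>

lemma integrable_mult_square_integrable:
  fixes f g :: "'a \<Rightarrow> real"
  assumes [measurable]: "f \<in> borel_measurable M" "g \<in> borel_measurable M"
    and int: "integrable M (\<lambda>x. (f x)\<^sup>2)" "integrable M (\<lambda>x. (g x)\<^sup>2)"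
  shows "integrable M (\<lambda>x. f x * g x)"
proof (rule Bochner_Integration.integrable_bound)
  show "integrable M (\<lambda>x. (f x)\<^sup>2 + (g x)\<^sup>2)" using int by auto
  have "\<bar>a * b\<bar> \<le> a\<^sup>2 + b\<^sup>2" for a b :: real
  proof -
    have "0 \<le> \<bar>a\<bar> * \<bar>b\<bar>" by simp
    then show ?thesis
      using sum_squares_bound[of "\<bar>a\<bar>" "\<bar>b\<bar>"] unfolding abs_mult power2_abs by linarith
  qed
  then show "AE x in M. norm (f x * g x) \<le> norm ((f x)\<^sup>2 + (g x)\<^sup>2)" by auto
qed measurable

lemma integrable_bounded_mult:
  fixes f \<xi> :: "'a \<Rightarrow> real"
  assumes "integrable M f" "\<xi> \<in> borel_measurable M" "\<And>\<omega>. \<omega> \<in> space M \<Longrightarrow> \<bar>\<xi> \<omega>\<bar> \<le> C"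
  shows "integrable M (\<lambda>\<omega>. \<xi> \<omega> * f \<omega>)"
proof (rule Bochner_Integration.integrable_bound)
  show "integrable M (\<lambda>\<omega>. C * f \<omega>)" using assms by auto
  have "\<bar>\<xi> \<omega>\<bar> * \<bar>f \<omega>\<bar> \<le> \<bar>C\<bar> * \<bar>f \<omega>\<bar>" if "\<omega> \<in> space M" for \<omega>
    using assms(3)[OF that] by (intro mult_right_mono) auto
  then show "AE \<omega> in M. norm (\<xi> \<omega> * f \<omega>) \<le> norm (C * f \<omega>)" by (auto simp: abs_mult)
qed (use assms in auto)

lemma (in pair_sigma_finite) has_bochner_integral_product:
  fixes f g :: "_ \<Rightarrow> real"
  assumes f: "integrable M1 f" and g: "integrable M2 g"
  shows "has_bochner_integral (M1 \<Otimes>\<^sub>M M2) (\<lambda>z. f (fst z) * g (snd z))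
    (integral\<^sup>L M1 f * integral\<^sup>L M2 g)"
proof -
  have [measurable]: "f \<in> borel_measurable M1" "g \<in> borel_measurable M2" using f g by auto
  have int: "integrable (M1 \<Otimes>\<^sub>M M2) (\<lambda>z. f (fst z) * g (snd z))"
    by (rule Fubini_integrable) (use f g in \<open>auto simp: abs_mult\<close>)
  moreover have "integral\<^sup>L (M1 \<Otimes>\<^sub>M M2) (\<lambda>z. f (fst z) * g (snd z)) = integral\<^sup>L M1 f * integral\<^sup>L M2 g"
    using integral_fst'[OF int] by simp
  ultimately show ?thesis by (simp add: has_bochner_integral_iff)
qed

lemma gauss_kernel_convolution_shift:
  assumes "s > 0" "t > 0"
  shows "has_bochner_integral lborel (\<lambda>x. gauss_kernel s (y + x) * gauss_kernel t x)
           (gauss_kernel (s + t) y)"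
  using gauss_kernel_convolution[OF assms, of "- y"]
    gauss_kernel_minus[of s "y + _"] by simp

context brownian_motion
begin

lemma integrable_increment_square:
  assumes "0 \<le> s" "s < t"
  shows "integrable M (\<lambda>\<omega>. (W t \<omega> - W s \<omega>)\<^sup>2)"
  using distributed_integrable[OF normal_increments[OF assms], of "\<lambda>x. x\<^sup>2"]
    gauss_kernel_moments(3)[of "t - s"] assms
  by (simp add: gauss_kernel_eq_normal_density has_bochner_integral_iff mult.commute)

lemma integrable_increment:
  assumes "0 \<le> s" "s < t"
  shows "integrable M (\<lambda>\<omega>. W t \<omega> - W s \<omega>)"
  using distributed_integrable[OF normal_increments[OF assms], of "\<lambda>x. x"]
    gauss_kernel_moments(2)[of "t - s"] assms
  by (simp add: gauss_kernel_eq_normal_density has_bochner_integral_iff mult.commute)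

lemma expectation_mult_increment:
  assumes st: "0 \<le> s" "s < t" and Z: "Z \<in> borel_measurable (F s)"
    and int: "integrable M (\<lambda>\<omega>. Z \<omega> * (W t \<omega> - W s \<omega>))"
  shows "expectation (\<lambda>\<omega>. Z \<omega> * (W t \<omega> - W s \<omega>)) = 0"
proof -
  have "expectation (\<lambda>\<omega>. Z \<omega> * (W t \<omega> - W s \<omega>))
      = expectation (\<lambda>\<omega>. LBINT x. Z \<omega> * x * gauss_kernel (t - s) x)"
    using expectation_increment[OF st, of "\<lambda>z. Z (fst z) * snd z"] Z int by simp
  moreover have "(LBINT x. Z \<omega> * x * gauss_kernel (t - s) x) = 0" for \<omega>
    using gauss_kernel_moments(2)[of "t - s"] st by (simp add: mult.assoc has_bochner_integral_iff)
  ultimately show ?thesis by simp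
qed

lemma expectation_mult_increment_square:
  assumes st: "0 \<le> s" "s < t" and \<xi>: "\<xi> \<in> borel_measurable (F s)"
    and bound: "\<And>\<omega>. \<omega> \<in> space M \<Longrightarrow> \<bar>\<xi> \<omega>\<bar> \<le> C"
  shows "integrable M (\<lambda>\<omega>. (\<xi> \<omega> * (W t \<omega> - W s \<omega>))\<^sup>2)"
    and "expectation (\<lambda>\<omega>. (\<xi> \<omega> * (W t \<omega> - W s \<omega>))\<^sup>2) = (t - s) * expectation (\<lambda>\<omega>. (\<xi> \<omega>)\<^sup>2)"
proof -
  have \<xi>M: "\<xi> \<in> borel_measurable M" using \<xi> st(1) by (rule measurable_filtration_M)
  have "\<bar>(\<xi> \<omega>)\<^sup>2\<bar> \<le> C\<^sup>2" if "\<omega> \<in> space M" for \<omega>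
    using bound[OF that] by (simp add: abs_le_square_iff[symmetric])
  then show int: "integrable M (\<lambda>\<omega>. (\<xi> \<omega> * (W t \<omega> - W s \<omega>))\<^sup>2)"
    unfolding power_mult_distrib using \<xi>M
    by (intro integrable_bounded_mult integrable_increment_square st) auto
  have "expectation (\<lambda>\<omega>. (\<xi> \<omega> * (W t \<omega> - W s \<omega>))\<^sup>2)
      = expectation (\<lambda>\<omega>. LBINT x. (\<xi> \<omega> * x)\<^sup>2 * gauss_kernel (t - s) x)"
    using expectation_increment[OF st, of "\<lambda>z. (\<xi> (fst z) * snd z)\<^sup>2"] \<xi> int by simp
  moreover have "(LBINT x. (\<xi> \<omega> * x)\<^sup>2 * gauss_kernel (t - s) x) = (t - s) * (\<xi> \<omega>)\<^sup>2" for \<omega>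
    using gauss_kernel_moments(3)[of "t - s"] st
    by (simp add: power_mult_distrib mult.assoc has_bochner_integral_iff)
  ultimately show "expectation (\<lambda>\<omega>. (\<xi> \<omega> * (W t \<omega> - W s \<omega>))\<^sup>2) = (t - s) * expectation (\<lambda>\<omega>. (\<xi> \<omega>)\<^sup>2)"
    by simp
qed

lemma integrable_kernel_mult:
  assumes s: "0 \<le> s" "s < T" and \<xi>: "\<xi> \<in> borel_measurable M"
    and bound: "\<And>\<omega>. \<omega> \<in> space M \<Longrightarrow> \<bar>\<xi> \<omega>\<bar> \<le> C"
  shows "integrable M (\<lambda>\<omega>. \<xi> \<omega> * gauss_kernel (T - s) (W s \<omega> - K))"
proof (intro integrable_bounded_mult[OF _ \<xi> bound])
  show "integrable M (\<lambda>\<omega>. gauss_kernel (T - s) (W s \<omega> - K))"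
    using s gauss_kernel_le[of "T - s"] by (intro integrable_const_bound) auto
qed auto

text \<open>The kernels form a semigroup under convolution, so integrating out the increment from \<open>s\<close>
  to \<open>r\<close> turns \<open>p(T - r, \<cdot>)\<close> into \<open>p(T - s, \<cdot>)\<close>.\<close>

lemma kernel_martingale:
  assumes sr: "0 \<le> s" "s < r" "r < T" and \<xi>: "\<xi> \<in> borel_measurable (F s)"
    and bound: "\<And>\<omega>. \<omega> \<in> space M \<Longrightarrow> \<bar>\<xi> \<omega>\<bar> \<le> C"
  shows "expectation (\<lambda>\<omega>. \<xi> \<omega> * gauss_kernel (T - r) (W r \<omega> - K))
    = expectation (\<lambda>\<omega>. \<xi> \<omega> * gauss_kernel (T - s) (W s \<omega> - K))"
proof -
  note [measurable] = \<xi> adapted[OF sr(1)]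
  have "integrable M (\<lambda>\<omega>. \<xi> \<omega> * gauss_kernel (T - r) (W r \<omega> - K))"
    using sr bound measurable_filtration_M[OF \<xi> sr(1)] by (intro integrable_kernel_mult) auto
  then have "expectation (\<lambda>\<omega>. \<xi> \<omega> * gauss_kernel (T - r) (W r \<omega> - K))
      = expectation (\<lambda>\<omega>. LBINT x. \<xi> \<omega> * gauss_kernel (T - r) (W s \<omega> - K + x) * gauss_kernel (r - s) x)"
    using expectation_increment[OF sr(1,2),
        of "\<lambda>z. \<xi> (fst z) * gauss_kernel (T - r) (W s (fst z) - K + snd z)"] by simp
  moreover have "(LBINT x. \<xi> \<omega> * gauss_kernel (T - r) (W s \<omega> - K + x) * gauss_kernel (r - s) x)
      = \<xi> \<omega> * gauss_kernel (T - s) (W s \<omega> - K)" for \<omega>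
    using gauss_kernel_convolution_shift[of "T - r" "r - s" "W s \<omega> - K"] sr
    by (simp add: mult.assoc has_bochner_integral_iff)
  ultimately show ?thesis by simp
qed

text \<open>Given the past of \<open>s\<close>, the event \<open>W\<^sub>t \<ge> k\<close> says that the increment is at least \<open>k - W\<^sub>s\<close>,
  so the truncated first moment of the increment appears.\<close>

lemma expectation_increment_indicator:
  assumes st: "0 \<le> s" "s < t" and \<xi>: "\<xi> \<in> borel_measurable (F s)"
    and bound: "\<And>\<omega>. \<omega> \<in> space M \<Longrightarrow> \<bar>\<xi> \<omega>\<bar> \<le> C"
  shows "expectation (\<lambda>\<omega>. \<xi> \<omega> * (W t \<omega> - W s \<omega>) * indicator {k..} (W t \<omega>))
    = (t - s) * expectation (\<lambda>\<omega>. \<xi> \<omega> * gauss_kernel (t - s) (W s \<omega> - k))"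
proof -
  note [measurable] = \<xi> adapted[OF st(1)]
  have "integrable M (\<lambda>\<omega>. \<xi> \<omega> * (W t \<omega> - W s \<omega>))"
    using st bound measurable_filtration_M[OF \<xi> st(1)]
    by (intro integrable_bounded_mult integrable_increment) auto
  moreover have "W t \<in> borel_measurable M" using st by simp
  ultimately have "integrable M (\<lambda>\<omega>. indicat_real {k..} (W t \<omega>) * (\<xi> \<omega> * (W t \<omega> - W s \<omega>)))"
    by (intro integrable_bounded_mult[where \<xi> = "\<lambda>\<omega>. indicat_real {k..} (W t \<omega>)" and C = 1]) auto
  then have "integrable M (\<lambda>\<omega>. \<xi> \<omega> * (W t \<omega> - W s \<omega>) * indicat_real {k..} (W t \<omega>))"
    by (simp add: mult.commute)
  then have "expectation (\<lambda>\<omega>. \<xi> \<omega> * (W t \<omega> - W s \<omega>) * indicator {k..} (W t \<omega>))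
      = expectation (\<lambda>\<omega>. LBINT x. \<xi> \<omega> * x * indicator {k..} (W s \<omega> + x) * gauss_kernel (t - s) x)"
    using expectation_increment[OF st,
        of "\<lambda>z. \<xi> (fst z) * snd z * indicator {k..} (W s (fst z) + snd z)"] by simp
  moreover have "(LBINT x. \<xi> \<omega> * x * indicator {k..} (W s \<omega> + x) * gauss_kernel (t - s) x)
      = (t - s) * (\<xi> \<omega> * gauss_kernel (t - s) (W s \<omega> - k))" for \<omega>
  proof -
    have "(LBINT x. \<xi> \<omega> * x * indicator {k..} (W s \<omega> + x) * gauss_kernel (t - s) x)
        = (LBINT x. \<xi> \<omega> * (x * gauss_kernel (t - s) x * indicator {k - W s \<omega>..} x))"
      by (intro Bochner_Integration.integral_cong) (auto simp: indicator_def)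
    then show ?thesis
      using gauss_kernel_truncated_moment[of "t - s" "k - W s \<omega>"] st
        gauss_kernel_diff_commute[of "t - s" k "W s \<omega>"]
      by (simp add: has_bochner_integral_iff)
  qed
  ultimately show ?thesis by simp
qed

text \<open>For \<open>t < T\<close> the last increment \<open>x = W\<^sub>T - W\<^sub>t\<close> only moves the threshold from \<open>K\<close> to
  \<open>K - x\<close>. Averaging the case of the indicator at time \<open>t\<close> over \<open>x\<close> with the kernel
  \<open>p(T - t, x)\<close> widens \<open>p(t - s, \<cdot>)\<close> to \<open>p(T - s, \<cdot>)\<close>. The expectation and the integral over
  \<open>x\<close> are exchanged twice, before and after the inner identity is applied.\<close>

lemma expectation_increment_terminal_indicator:
  assumes st: "0 \<le> s" "s < t" "t \<le> T" and \<xi>: "\<xi> \<in> borel_measurable (F s)"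
    and bound: "\<And>\<omega>. \<omega> \<in> space M \<Longrightarrow> \<bar>\<xi> \<omega>\<bar> \<le> C"
  shows "expectation (\<lambda>\<omega>. \<xi> \<omega> * (W t \<omega> - W s \<omega>) * indicator {K..} (W T \<omega>))
    = (t - s) * expectation (\<lambda>\<omega>. \<xi> \<omega> * gauss_kernel (T - s) (W s \<omega> - K))"
proof (cases "t = T")
  case True
  then show ?thesis using expectation_increment_indicator[OF st(1,2) \<xi> bound] by simp
next
  case False
  then have tT: "0 \<le> t" "t < T" "0 < T - t" "0 < t - s" using st by auto
  have \<xi>t [measurable]: "\<xi> \<in> borel_measurable (F t)" "W s \<in> borel_measurable (F t)"
    using \<xi> adapted[OF st(1)] st(2) by (auto intro: measurable_filtration_mono)
  have [measurable]: "\<xi> \<in> borel_measurable M" "W s \<in> borel_measurable M" "W t \<in> borel_measurable M"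
    "W T \<in> borel_measurable M" "W t \<in> borel_measurable (F t)"
    using measurable_filtration_M[OF \<xi>] st tT adapted by auto
  interpret P: pair_sigma_finite M lborel ..
  let ?Y = "\<lambda>\<omega>. \<xi> \<omega> * (W t \<omega> - W s \<omega>)"
  have Y: "integrable M ?Y"
    using st bound by (intro integrable_bounded_mult integrable_increment) auto
  then have "integrable M (\<lambda>\<omega>. indicat_real {K..} (W T \<omega>) * ?Y \<omega>)"
    by (rule integrable_bounded_mult[where \<xi> = "\<lambda>\<omega>. indicat_real {K..} (W T \<omega>)" and C = 1]) auto
  then have "integrable M (\<lambda>\<omega>. ?Y \<omega> * indicator {K..} (W t \<omega> + (W T \<omega> - W t \<omega>)))"
    by (simp add: mult.commute)
  then have "expectation (\<lambda>\<omega>. ?Y \<omega> * indicator {K..} (W T \<omega>))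
      = expectation (\<lambda>\<omega>. LBINT x. ?Y \<omega> * indicator {K..} (W t \<omega> + x) * gauss_kernel (T - t) x)"
    using expectation_increment[OF tT(1,2),
        of "\<lambda>z. ?Y (fst z) * indicator {K..} (W t (fst z) + snd z)"] by simp
  also have "\<dots> = (LBINT x. expectation (\<lambda>\<omega>. ?Y \<omega> * indicator {K..} (W t \<omega> + x) * gauss_kernel (T - t) x))"
  proof (rule P.Fubini_integral[symmetric])
    have "integrable (M \<Otimes>\<^sub>M lborel) (\<lambda>z. ?Y (fst z) * gauss_kernel (T - t) (snd z))"
      using P.has_bochner_integral_product[OF Y integrable_gauss_kernel[OF tT(3)]]
      by (simp add: has_bochner_integral_iff)
    then show "integrable (M \<Otimes>\<^sub>M lborel)
        (\<lambda>(\<omega>, x). ?Y \<omega> * indicator {K..} (W t \<omega> + x) * gauss_kernel (T - t) x)"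
    proof (rule Bochner_Integration.integrable_bound)
      show "AE z in M \<Otimes>\<^sub>M lborel. norm (case z of (\<omega>, x) \<Rightarrow>
          ?Y \<omega> * indicator {K..} (W t \<omega> + x) * gauss_kernel (T - t) x)
          \<le> norm (?Y (fst z) * gauss_kernel (T - t) (snd z))"
        by (auto split: split_indicator)
    qed measurable
  qed
  also have "\<dots> = (LBINT x. expectation (\<lambda>\<omega>.
      (t - s) * (\<xi> \<omega> * gauss_kernel (t - s) (W s \<omega> - K + x) * gauss_kernel (T - t) x)))"
  proof (rule Bochner_Integration.integral_cong[OF refl])
    fix x :: real
    have "indicat_real {K..} (w + x) = indicator {K - x..} w" for w by (auto simp: indicator_def)
    then have "expectation (\<lambda>\<omega>. ?Y \<omega> * indicator {K..} (W t \<omega> + x) * gauss_kernel (T - t) x)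
        = (t - s) * expectation (\<lambda>\<omega>. \<xi> \<omega> * gauss_kernel (t - s) (W s \<omega> - (K - x))) * gauss_kernel (T - t) x"
      using expectation_increment_indicator[OF st(1,2) \<xi> bound, of "K - x"] by simp
    moreover have "W s \<omega> - (K - x) = W s \<omega> - K + x" for \<omega> by simp
    ultimately show "expectation (\<lambda>\<omega>. ?Y \<omega> * indicator {K..} (W t \<omega> + x) * gauss_kernel (T - t) x)
        = expectation (\<lambda>\<omega>. (t - s) * (\<xi> \<omega> * gauss_kernel (t - s) (W s \<omega> - K + x) * gauss_kernel (T - t) x))"
      by simp
  qed
  also have "\<dots> = expectation (\<lambda>\<omega>. LBINT x.
      (t - s) * (\<xi> \<omega> * gauss_kernel (t - s) (W s \<omega> - K + x) * gauss_kernel (T - t) x))"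
  proof (rule P.Fubini_integral)
    define D where "D = (t - s) * C * (1 / sqrt (2 * pi * (t - s)))"
    have "integrable (M \<Otimes>\<^sub>M lborel) (\<lambda>z. (\<lambda>_. D) (fst z) * gauss_kernel (T - t) (snd z))"
      using P.has_bochner_integral_product[of "\<lambda>_. D", OF _ integrable_gauss_kernel[OF tT(3)]]
      by (simp add: has_bochner_integral_iff)
    then show "integrable (M \<Otimes>\<^sub>M lborel) (\<lambda>(\<omega>, x).
        (t - s) * (\<xi> \<omega> * gauss_kernel (t - s) (W s \<omega> - K + x) * gauss_kernel (T - t) x))"
    proof (rule Bochner_Integration.integrable_bound)
      show "AE z in M \<Otimes>\<^sub>M lborel. norm (case z of (\<omega>, x) \<Rightarrow>
          (t - s) * (\<xi> \<omega> * gauss_kernel (t - s) (W s \<omega> - K + x) * gauss_kernel (T - t) x))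
          \<le> norm ((\<lambda>_. D) (fst z) * gauss_kernel (T - t) (snd z))"
      proof (rule AE_I2)
        fix z :: "'a \<times> real" assume "z \<in> space (M \<Otimes>\<^sub>M lborel)"
        then obtain \<omega> x where z: "z = (\<omega>, x)" and \<omega>: "\<omega> \<in> space M" by (auto simp: space_pair_measure)
        have "\<bar>\<xi> \<omega>\<bar> * gauss_kernel (t - s) (W s \<omega> - K + x) \<le> C * (1 / sqrt (2 * pi * (t - s)))"
          using bound[OF \<omega>] gauss_kernel_le[OF tT(4)] tT by (intro mult_mono) auto
        then have "(t - s) * (\<bar>\<xi> \<omega>\<bar> * gauss_kernel (t - s) (W s \<omega> - K + x)) * gauss_kernel (T - t) x
            \<le> D * gauss_kernel (T - t) x"
          unfolding D_def mult.assoc[of "t - s"] using tT by (intro mult_right_mono mult_left_mono) auto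
        also have "\<dots> \<le> \<bar>D\<bar> * gauss_kernel (T - t) x" using tT by (intro mult_right_mono) auto
        finally show "norm (case z of (\<omega>, x) \<Rightarrow>
          (t - s) * (\<xi> \<omega> * gauss_kernel (t - s) (W s \<omega> - K + x) * gauss_kernel (T - t) x))
          \<le> norm ((\<lambda>_. D) (fst z) * gauss_kernel (T - t) (snd z))"
          using tT by (simp add: z abs_mult mult.assoc)
      qed
    qed measurable
  qed
  also have "\<dots> = expectation (\<lambda>\<omega>. (t - s) * (\<xi> \<omega> * gauss_kernel (T - s) (W s \<omega> - K)))"
    using gauss_kernel_convolution_shift[OF tT(4,3)]
    by (intro Bochner_Integration.integral_cong) (simp_all add: mult.assoc has_bochner_integral_iff)
  finally show ?thesis by simp
qed

text \<open>The squared kernel is a multiple of the kernel of variance \<open>(T - s) / 2\<close>; convolving it with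
  the law of \<open>W\<^sub>s - W\<^sub>0\<close> yields variance \<open>(T + s) / 2\<close>.\<close>

lemma expectation_kernel_square:
  assumes s: "0 \<le> s" "s < T"
  shows "integrable M (\<lambda>\<omega>. (gauss_kernel (T - s) (W s \<omega> - K))\<^sup>2)"
    and "expectation (\<lambda>\<omega>. (gauss_kernel (T - s) (W s \<omega> - K))\<^sup>2) = kernel_energy T (K - w0) s"
proof -
  have pos: "0 < T - s" "0 < (T - s) / 2" "0 < T" using s by auto
  have [measurable]: "W s \<in> borel_measurable M" "W 0 \<in> borel_measurable M" "W 0 \<in> borel_measurable (F 0)"
    using s adapted by auto
  show int: "integrable M (\<lambda>\<omega>. (gauss_kernel (T - s) (W s \<omega> - K))\<^sup>2)"
    using gauss_kernel_le[OF pos(1)] pos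
    by (intro integrable_const_bound[where B = "(1 / sqrt (2 * pi * (T - s)))\<^sup>2"])
       (auto intro!: power_mono)
  have key: "gauss_kernel ((T + s) / 2) (w0 - K) / (2 * sqrt (pi * (T - s))) = kernel_energy T (K - w0) s"
  proof -
    have "T\<^sup>2 - s\<^sup>2 = (T + s) * (T - s)" by (simp add: power2_eq_square algebra_simps)
    then have "2 * pi * sqrt (T\<^sup>2 - s\<^sup>2) = sqrt (pi * (T + s)) * (2 * sqrt (pi * (T - s)))"
      by (simp add: real_sqrt_mult)
    moreover have "gauss_kernel ((T + s) / 2) (w0 - K) = exp (- (K - w0)\<^sup>2 / (T + s)) / sqrt (pi * (T + s))"
    proof -
      have 1: "2 * pi * ((T + s) / 2) = pi * (T + s)" and 2: "2 * ((T + s) / 2) = T + s"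
        by (simp_all add: field_simps)
      show ?thesis unfolding gauss_kernel_def 1 2 power2_commute[of w0 K] by simp
    qed
    ultimately show ?thesis
      unfolding kernel_energy_def by (simp only: divide_divide_eq_left)
  qed
  show "expectation (\<lambda>\<omega>. (gauss_kernel (T - s) (W s \<omega> - K))\<^sup>2) = kernel_energy T (K - w0) s"
  \<comment> \<open>At time 0 there is no increment with a density; the value comes from the starting point.\<close>
  proof (cases "s = 0")
    case True
    have "expectation (\<lambda>\<omega>. (gauss_kernel (T - s) (W s \<omega> - K))\<^sup>2)
        = expectation (\<lambda>\<omega>. (gauss_kernel (T - s) (w0 - K))\<^sup>2)"
      using start True by (intro integral_cong_AE) auto
    also have "\<dots> = (gauss_kernel T (w0 - K))\<^sup>2" using True by (simp add: prob_space)
    also have "\<dots> = kernel_energy T (K - w0) s"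
      using gauss_kernel_square[OF pos(3), of "w0 - K"] True key by simp
    finally show ?thesis .
  next
    case False
    then have s0: "0 \<le> (0::real)" "0 < s" using s by auto
    have "expectation (\<lambda>\<omega>. (gauss_kernel (T - s) (W s \<omega> - K))\<^sup>2)
        = expectation (\<lambda>\<omega>. LBINT x. (gauss_kernel (T - s) (W 0 \<omega> - K + x))\<^sup>2 * gauss_kernel s x)"
      using expectation_increment[OF s0, of "\<lambda>z. (gauss_kernel (T - s) (W 0 (fst z) - K + snd z))\<^sup>2"] int
      by simp
    also have "\<dots> = expectation (\<lambda>\<omega>. gauss_kernel ((T + s) / 2) (W 0 \<omega> - K) / (2 * sqrt (pi * (T - s))))"
    proof (rule Bochner_Integration.integral_cong[OF refl])
      fix \<omega>
      have eq: "(T - s) / 2 + s = (T + s) / 2" by (simp add: field_simps)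
      show "(LBINT x. (gauss_kernel (T - s) (W 0 \<omega> - K + x))\<^sup>2 * gauss_kernel s x)
          = gauss_kernel ((T + s) / 2) (W 0 \<omega> - K) / (2 * sqrt (pi * (T - s)))"
        using gauss_kernel_convolution_shift[OF pos(2) s0(2), of "W 0 \<omega> - K", unfolded eq]
        unfolding gauss_kernel_square[OF pos(1)] by (simp add: has_bochner_integral_iff)
    qed
    also have "\<dots> = expectation (\<lambda>\<omega>. gauss_kernel ((T + s) / 2) (w0 - K) / (2 * sqrt (pi * (T - s))))"
    proof (rule integral_cong_AE)
      show "AE \<omega> in M. gauss_kernel ((T + s) / 2) (W 0 \<omega> - K) / (2 * sqrt (pi * (T - s)))
          = gauss_kernel ((T + s) / 2) (w0 - K) / (2 * sqrt (pi * (T - s)))"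
        using start by eventually_elim simp
    qed measurable
    also have "\<dots> = kernel_energy T (K - w0) s" using key by (simp add: prob_space)
    finally show ?thesis .
  qed
qed

text \<open>The two half-lines differ by a point, to which the normal law gives no mass. This is why
  the theorem may combine the closed half-line with the probability of the open one.\<close>

lemma expectation_terminal_indicator:
  assumes T: "0 < T" and A: "A = {K<..} \<or> A = {K..}"
  shows "expectation (\<lambda>\<omega>. indicat_real A (W T \<omega>)) = 1 - gauss_cdf T (K - w0)"
proof -
  have T0: "0 \<le> (0::real)" "0 < T" using T by auto
  have [measurable]: "W T \<in> borel_measurable M" "W 0 \<in> borel_measurable M" "W 0 \<in> borel_measurable (F 0)"
    "A \<in> sets borel"
    using T A adapted by auto
  have "integrable M (\<lambda>\<omega>. indicat_real A (W T \<omega>))"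
    by (intro integrable_const_bound[where B = 1]) auto
  then have "expectation (\<lambda>\<omega>. indicat_real A (W T \<omega>))
      = expectation (\<lambda>\<omega>. LBINT x. indicat_real A (W 0 \<omega> + x) * gauss_kernel T x)"
    using expectation_increment[OF T0, of "\<lambda>z. indicat_real A (W 0 (fst z) + snd z)"] by simp
  also have "\<dots> = expectation (\<lambda>\<omega>. LBINT x. indicat_real A (w0 + x) * gauss_kernel T x)"
    using start by (intro integral_cong_AE) auto
  also have "\<dots> = (LBINT x. indicat_real A (w0 + x) * gauss_kernel T x)" by (simp add: prob_space)
  also have "\<dots> = (LBINT x. gauss_kernel T x - gauss_kernel T x * indicator {..K - w0} x)"
    using AE_lborel_singleton[of "K - w0"] A by (intro integral_cong_AE) (auto simp: indicator_def)
  also have "\<dots> = 1 - gauss_cdf T (K - w0)"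
    unfolding gauss_cdf_def using gauss_kernel_moments(1)[OF T] T
    by (subst Bochner_Integration.integral_diff)
       (auto simp: has_bochner_integral_iff intro!: integrable_gauss_kernel integrable_gauss_kernel_indicator)
  finally show ?thesis .
qed

end

section \<open>Simple processes compared with the kernel\<close>

lemma simple_process_square:
  assumes "\<And>i. i < n \<Longrightarrow> t i < t (Suc i)"
  shows "(simple_process n t \<xi> s \<omega>)\<^sup>2 = (\<Sum>i<n. (\<xi> i \<omega>)\<^sup>2 * indicator {t i<..t (Suc i)} s)"
proof (cases "\<exists>i<n. t i < s \<and> s \<le> t (Suc i)")
  case True
  then obtain i where i: "i < n" "t i < s" "s \<le> t (Suc i)" by auto
  show ?thesis
    unfolding simple_process_def
    using sum_partition_indicator[OF assms i, of "\<lambda>i. \<xi> i \<omega>"]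
      sum_partition_indicator[OF assms i, of "\<lambda>i. (\<xi> i \<omega>)\<^sup>2"] by simp
next
  case False
  then have "indicator {t i<..t (Suc i)} s = (0::real)" if "i < n" for i using that by auto
  then show ?thesis by (simp add: simple_process_def)
qed

lemma integrable_indicator_interval:
  "integrable lborel (indicat_real {a<..b :: real})"
  by (cases "a \<le> b") (auto intro!: integrable_real_indicator simp: emeasure_lborel_Ioc)

lemma sets_pair_lborel: "sets (M \<Otimes>\<^sub>M lborel) = sets (M \<Otimes>\<^sub>M (borel :: real measure))"
  by (rule sets_pair_measure_cong) auto

context brownian_motion
begin

text \<open>The candidate for the value of the stochastic integral.\<close>

definition centred_payoff :: "real \<Rightarrow> real \<Rightarrow> 'a \<Rightarrow> real" where
  "centred_payoff T K \<omega> = indicator {K..} (W T \<omega>) - prob {\<omega> \<in> space M. W T \<omega> > K}"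

text \<open>The integrand cut off outside \<open>[0, T]\<close>, as a function on the product of \<open>M\<close> with
  Lebesgue measure. The norm of processes becomes an ordinary \<open>L\<^sup>2\<close> norm on this product,
  where Fubini's theorem applies.\<close>

definition kernel_integrand :: "real \<Rightarrow> real \<Rightarrow> 'a \<times> real \<Rightarrow> real" where
  "kernel_integrand T K = (\<lambda>(\<omega>, s). indicator {0..T} s * gauss_kernel (T - s) (W s \<omega> - K))"

lemma prob_terminal_greater:
  assumes "0 < T" shows "prob {\<omega> \<in> space M. W T \<omega> > K} = 1 - gauss_cdf T (K - w0)"
proof -
  have [measurable]: "W T \<in> borel_measurable M" using assms by simp
  have "expectation (\<lambda>\<omega>. indicat_real {K<..} (W T \<omega>))
      = expectation (indicat_real {\<omega> \<in> space M. W T \<omega> > K})"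
    by (intro Bochner_Integration.integral_cong) (auto simp: indicator_def)
  also have "\<dots> = prob {\<omega> \<in> space M. W T \<omega> > K}"
    by simp
  finally show ?thesis using expectation_terminal_indicator[OF assms, of "{K<..}" K] by simp
qed

lemma centred_payoff_measurable [measurable]:
  "0 < T \<Longrightarrow> centred_payoff T K \<in> borel_measurable M"
  unfolding centred_payoff_def[abs_def] using borel_measurable_W[of T] by measurable

lemma centred_payoff_square:
  assumes T: "0 < T"
  shows "integrable M (\<lambda>\<omega>. (centred_payoff T K \<omega>)\<^sup>2)"
    and "expectation (\<lambda>\<omega>. (centred_payoff T K \<omega>)\<^sup>2)
      = gauss_cdf T (K - w0) * (1 - gauss_cdf T (K - w0))"
proof -
  define p where "p = 1 - gauss_cdf T (K - w0)"
  have [measurable]: "W T \<in> borel_measurable M" using T by simp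
  have ind: "integrable M (\<lambda>\<omega>. indicat_real {K..} (W T \<omega>))"
    by (intro integrable_const_bound[where B = 1]) auto
  have sq: "(centred_payoff T K \<omega>)\<^sup>2 = (1 - 2 * p) * indicator {K..} (W T \<omega>) + p\<^sup>2" for \<omega>
    using prob_terminal_greater[OF T, of K]
    by (simp add: centred_payoff_def p_def[symmetric] power2_eq_square algebra_simps split: split_indicator)
  show "integrable M (\<lambda>\<omega>. (centred_payoff T K \<omega>)\<^sup>2)"
    unfolding sq using ind by auto
  have "expectation (\<lambda>\<omega>. (centred_payoff T K \<omega>)\<^sup>2) = (1 - 2 * p) * p + p\<^sup>2"
    unfolding sq using ind expectation_terminal_indicator[OF T, of "{K..}" K] by (simp add: p_def prob_space)
  then show "expectation (\<lambda>\<omega>. (centred_payoff T K \<omega>)\<^sup>2)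
      = gauss_cdf T (K - w0) * (1 - gauss_cdf T (K - w0))"
    by (simp add: p_def power2_eq_square algebra_simps)
qed

lemma kernel_integrand_measurable [measurable]:
  assumes "0 < T"
  shows "kernel_integrand T K \<in> borel_measurable (M \<Otimes>\<^sub>M lborel)"
proof -
  have "(\<lambda>(s, \<omega>). W (max 0 (min T s)) \<omega>) \<in> borel_measurable (borel \<Otimes>\<^sub>M F T)"
    using assms by (intro borel_measurable_W_joint) simp
  moreover have "(\<lambda>z. (snd z, fst z)) \<in> measurable (M \<Otimes>\<^sub>M borel) (borel \<Otimes>\<^sub>M F T)"
    using measurable_M_filtration[of T] assms
    by (intro measurable_Pair measurable_snd measurable_compose[OF measurable_fst]) auto
  ultimately have "(\<lambda>z. (\<lambda>(s, \<omega>). W (max 0 (min T s)) \<omega>) (snd z, fst z))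
      \<in> borel_measurable (M \<Otimes>\<^sub>M borel)"
    by (rule measurable_compose[rotated])
  then have [measurable]: "(\<lambda>z. W (max 0 (min T (snd z))) (fst z)) \<in> borel_measurable (M \<Otimes>\<^sub>M lborel)"
    unfolding measurable_cong_sets[OF sets_pair_lborel refl] by simp
  have "(\<lambda>z. indicator {0..T} (snd z) * gauss_kernel (T - snd z) (W (max 0 (min T (snd z))) (fst z) - K))
      \<in> borel_measurable (M \<Otimes>\<^sub>M lborel)" by measurable
  also have "(\<lambda>z. indicator {0..T} (snd z) * gauss_kernel (T - snd z) (W (max 0 (min T (snd z))) (fst z) - K))
      = kernel_integrand T K"
    by (auto simp: kernel_integrand_def fun_eq_iff indicator_def max_def min_def)
  finally show ?thesis .
qed

lemma progressively_measurable_kernel: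
  "progressively_measurable_upto F T (\<lambda>s \<omega>. gauss_kernel (T - s) (W s \<omega> - K))"
  unfolding progressively_measurable_upto_def
proof
  fix t assume t: "t \<in> {0..T}"
  let ?N = "restrict_space borel {0..t} \<Otimes>\<^sub>M F t"
  have "(\<lambda>s. s) \<in> measurable (restrict_space borel {0..t}) (borel :: real measure)"
    by (rule measurable_restrict_space1) simp
  then have [measurable]: "fst \<in> measurable ?N (borel :: real measure)"
    by (intro measurable_compose[OF measurable_fst]) simp
  have "(\<lambda>z. (fst z, snd z)) \<in> measurable ?N (borel \<Otimes>\<^sub>M F t)" by measurable
  from measurable_compose[OF this borel_measurable_W_joint[of t]]
  have [measurable]: "(\<lambda>z. W (max 0 (min t (fst z))) (snd z)) \<in> borel_measurable ?N"
    using t by simp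
  have "(\<lambda>z. gauss_kernel (T - fst z) (W (max 0 (min t (fst z))) (snd z) - K)) \<in> borel_measurable ?N"
    by measurable
  then show "(\<lambda>(s, \<omega>). gauss_kernel (T - s) (W s \<omega> - K)) \<in> borel_measurable ?N"
    by (rule measurable_cong[THEN iffD1, rotated])
       (auto simp: space_pair_measure space_restrict_space)
qed

lemma kernel_integrand_square:
  assumes T: "0 < T"
  shows "has_bochner_integral (M \<Otimes>\<^sub>M lborel) (\<lambda>z. (kernel_integrand T K z)\<^sup>2)
    (gauss_cdf T (K - w0) * (1 - gauss_cdf T (K - w0)))"
proof (rule has_bochner_integral_nn_integral)
  note [measurable] = kernel_integrand_measurable[OF T, of K]
  interpret P: pair_sigma_finite M lborel ..
  have "(\<integral>\<^sup>+z. ennreal ((kernel_integrand T K z)\<^sup>2) \<partial>(M \<Otimes>\<^sub>M lborel))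
      = (\<integral>\<^sup>+s. (\<integral>\<^sup>+\<omega>. ennreal ((kernel_integrand T K (\<omega>, s))\<^sup>2) \<partial>M) \<partial>lborel)"
    by (rule P.nn_integral_snd[symmetric]) measurable
  also have "\<dots> = (\<integral>\<^sup>+s. ennreal (kernel_energy T (K - w0) s) * indicator {0..T} s \<partial>lborel)"
  proof (rule nn_integral_cong_AE)
    show "AE s in lborel. (\<integral>\<^sup>+\<omega>. ennreal ((kernel_integrand T K (\<omega>, s))\<^sup>2) \<partial>M)
        = ennreal (kernel_energy T (K - w0) s) * indicator {0..T} s"
      using AE_lborel_singleton[of T]
    proof eventually_elim
      fix s assume "s \<noteq> T"
      show "(\<integral>\<^sup>+\<omega>. ennreal ((kernel_integrand T K (\<omega>, s))\<^sup>2) \<partial>M)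
        = ennreal (kernel_energy T (K - w0) s) * indicator {0..T} s"
      proof (cases "s \<in> {0..T}")
        case True
        with \<open>s \<noteq> T\<close> have s: "0 \<le> s" "s < T" by auto
        have "(\<integral>\<^sup>+\<omega>. ennreal ((kernel_integrand T K (\<omega>, s))\<^sup>2) \<partial>M)
            = ennreal (expectation (\<lambda>\<omega>. (gauss_kernel (T - s) (W s \<omega> - K))\<^sup>2))"
          using True expectation_kernel_square(1)[OF s]
          by (subst nn_integral_eq_integral[symmetric]) (auto simp: kernel_integrand_def)
        then show ?thesis using True expectation_kernel_square(2)[OF s] by simp
      qed (simp add: kernel_integrand_def)
    qed
  qed
  also have "\<dots> = ennreal (gauss_cdf T (K - w0) * (1 - gauss_cdf T (K - w0)))"
    by (rule nn_integral_kernel_energy[OF T])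
  finally show "(\<integral>\<^sup>+z. ennreal ((kernel_integrand T K z)\<^sup>2) \<partial>(M \<Otimes>\<^sub>M lborel))
      = ennreal (gauss_cdf T (K - w0) * (1 - gauss_cdf T (K - w0)))" .
  show "0 \<le> gauss_cdf T (K - w0) * (1 - gauss_cdf T (K - w0))"
    unfolding centred_payoff_square(2)[OF T, symmetric] by simp
qed (use T in auto)

context
  fixes T K :: real and n :: nat and t :: "nat \<Rightarrow> real" and \<xi> :: "nat \<Rightarrow> 'a \<Rightarrow> real" and C :: real
  assumes T: "0 < T"
    and t0: "t 0 = 0" and tn: "t n = T"
    and t_less: "\<And>i. i < n \<Longrightarrow> t i < t (Suc i)"
    and \<xi>_meas: "\<And>i. i < n \<Longrightarrow> \<xi> i \<in> borel_measurable (F (t i))"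
    and \<xi>_bound: "\<And>i \<omega>. i < n \<Longrightarrow> \<omega> \<in> space M \<Longrightarrow> \<bar>\<xi> i \<omega>\<bar> \<le> C"
begin

private lemma t_bounds:
  assumes "i < n" shows "0 \<le> t i" "t i < t (Suc i)" "t (Suc i) \<le> T"
  using partition_mono[of n t 0 i, OF t_less] partition_mono[of n t "Suc i" n, OF t_less] assms t_less t0 tn
  by auto

private lemma \<xi>_meas_M: "i < n \<Longrightarrow> \<xi> i \<in> borel_measurable M"
  using measurable_filtration_M[OF \<xi>_meas] t_bounds by blast

private lemma \<xi>_square_integrable:
  assumes "i < n" shows "integrable M (\<lambda>\<omega>. (\<xi> i \<omega>)\<^sup>2)"
proof -
  have "\<bar>\<xi> i \<omega>\<bar>\<^sup>2 \<le> C\<^sup>2" if "\<omega> \<in> space M" for \<omega>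
    using \<xi>_bound[OF assms that] by (intro power_mono) auto
  then show ?thesis
    using \<xi>_meas_M[OF assms] by (intro integrable_const_bound[where B = "C\<^sup>2"]) auto
qed

private lemma simple_ito_integral_adapted:
  "m \<le> n \<Longrightarrow> simple_ito_integral W m t \<xi> \<in> borel_measurable (F (t m))"
  unfolding simple_ito_integral_def[abs_def]
proof (intro borel_measurable_sum borel_measurable_times borel_measurable_diff)
  fix i assume "m \<le> n" "i \<in> {..<m}"
  then have i: "i < n" and le: "t (Suc i) \<le> t m" "t i \<le> t m"
    using partition_mono[of n t "Suc i" m, OF t_less] partition_mono[of n t i m, OF t_less] by auto
  show "\<xi> i \<in> borel_measurable (F (t m))" using \<xi>_meas[OF i] le(2) by (rule measurable_filtration_mono)
  show "W (t (Suc i)) \<in> borel_measurable (F (t m))"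
    using le(1) t_bounds[OF i] by (intro measurable_filtration_mono[OF adapted]) auto
  show "W (t i) \<in> borel_measurable (F (t m))"
    using le(2) t_bounds[OF i] by (intro measurable_filtration_mono[OF adapted]) auto
qed

text \<open>The next increment is independent of the past and centred, so it is orthogonal to the sum
  so far; each step of the induction adds only its own second moment.\<close>

lemma simple_ito_isometry:
  assumes "m \<le> n"
  shows "integrable M (\<lambda>\<omega>. (simple_ito_integral W m t \<xi> \<omega>)\<^sup>2)
    \<and> expectation (\<lambda>\<omega>. (simple_ito_integral W m t \<xi> \<omega>)\<^sup>2)
      = (\<Sum>i<m. (t (Suc i) - t i) * expectation (\<lambda>\<omega>. (\<xi> i \<omega>)\<^sup>2))"
  using assms
proof (induction m)
  case 0 then show ?case by (simp add: simple_ito_integral_def)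
next
  case (Suc m)
  then have m: "m < n" by simp
  let ?S = "simple_ito_integral W m t \<xi>"
  let ?A = "\<lambda>\<omega>. W (t (Suc m)) \<omega> - W (t m) \<omega>"
  let ?Y = "\<lambda>\<omega>. \<xi> m \<omega> * ?A \<omega>"
  note tm = t_bounds[OF m]
  have S: "?S \<in> borel_measurable (F (t m))" using m by (intro simple_ito_integral_adapted) simp
  have [measurable]: "?S \<in> borel_measurable M" "\<xi> m \<in> borel_measurable M"
    "W (t (Suc m)) \<in> borel_measurable M" "W (t m) \<in> borel_measurable M"
    using measurable_filtration_M[OF S] \<xi>_meas_M[OF m] tm by auto
  have int_S: "integrable M (\<lambda>\<omega>. (?S \<omega>)\<^sup>2)" using Suc by simp
  have int_Y: "integrable M (\<lambda>\<omega>. (?Y \<omega>)\<^sup>2)" and E_Y: "expectation (\<lambda>\<omega>. (?Y \<omega>)\<^sup>2)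
      = (t (Suc m) - t m) * expectation (\<lambda>\<omega>. (\<xi> m \<omega>)\<^sup>2)"
    using expectation_mult_increment_square[OF tm(1,2) \<xi>_meas[OF m] \<xi>_bound[OF m]] by auto
  have int_SY: "integrable M (\<lambda>\<omega>. ?S \<omega> * ?Y \<omega>)"
    by (intro integrable_mult_square_integrable int_S int_Y) measurable
  have "expectation (\<lambda>\<omega>. ?S \<omega> * \<xi> m \<omega> * ?A \<omega>) = 0"
    using int_SY S \<xi>_meas[OF m]
    by (intro expectation_mult_increment tm) (auto simp: mult.assoc)
  then have E_SY: "expectation (\<lambda>\<omega>. ?S \<omega> * ?Y \<omega>) = 0" by (simp add: mult.assoc)
  have eq: "(simple_ito_integral W (Suc m) t \<xi> \<omega>)\<^sup>2 = (?S \<omega>)\<^sup>2 + 2 * (?S \<omega> * ?Y \<omega>) + (?Y \<omega>)\<^sup>2" for \<omega>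
    by (simp add: simple_ito_integral_def power2_sum)
  have "integrable M (\<lambda>\<omega>. (simple_ito_integral W (Suc m) t \<xi> \<omega>)\<^sup>2)"
    unfolding eq using int_S int_SY int_Y by auto
  moreover have "expectation (\<lambda>\<omega>. (simple_ito_integral W (Suc m) t \<xi> \<omega>)\<^sup>2)
      = expectation (\<lambda>\<omega>. (?S \<omega>)\<^sup>2) + 2 * expectation (\<lambda>\<omega>. ?S \<omega> * ?Y \<omega>) + expectation (\<lambda>\<omega>. (?Y \<omega>)\<^sup>2)"
    unfolding eq using int_S int_SY int_Y by simp
  ultimately show ?case using Suc E_SY E_Y by simp
qed

text \<open>Only the indicator contributes to the product: the constant part of the payoff is multiplied by
  the mean of an elementary integral, which is 0.\<close>

lemma simple_ito_integral_times_payoff: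
  shows "integrable M (\<lambda>\<omega>. simple_ito_integral W n t \<xi> \<omega> * centred_payoff T K \<omega>)"
    and "expectation (\<lambda>\<omega>. simple_ito_integral W n t \<xi> \<omega> * centred_payoff T K \<omega>)
      = (\<Sum>i<n. (t (Suc i) - t i)
          * expectation (\<lambda>\<omega>. \<xi> i \<omega> * gauss_kernel (T - t i) (W (t i) \<omega> - K)))"
proof -
  have [measurable]: "W T \<in> borel_measurable M" using T by simp
  define p where "p = prob {\<omega> \<in> space M. W T \<omega> > K}"
  let ?Y = "\<lambda>i \<omega>. \<xi> i \<omega> * (W (t (Suc i)) \<omega> - W (t i) \<omega>)"
  have summand: "has_bochner_integral M (\<lambda>\<omega>. ?Y i \<omega> * centred_payoff T K \<omega>)
      ((t (Suc i) - t i) * expectation (\<lambda>\<omega>. \<xi> i \<omega> * gauss_kernel (T - t i) (W (t i) \<omega> - K)))"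
    if i: "i < n" for i
  proof -
    have Y: "integrable M (?Y i)"
      using t_bounds[OF i] \<xi>_meas_M[OF i] \<xi>_bound[OF i]
      by (intro integrable_bounded_mult integrable_increment) auto
    have "integrable M (\<lambda>\<omega>. indicat_real {K..} (W T \<omega>) * ?Y i \<omega>)"
      using Y by (intro integrable_bounded_mult[where \<xi> = "\<lambda>\<omega>. indicat_real {K..} (W T \<omega>)" and C = 1]) auto
    then have YI: "integrable M (\<lambda>\<omega>. ?Y i \<omega> * indicat_real {K..} (W T \<omega>))"
      by (simp only: mult.commute)
    have "expectation (?Y i) = 0"
      using t_bounds[OF i] \<xi>_meas[OF i] Y by (intro expectation_mult_increment) auto
    moreover have "expectation (\<lambda>\<omega>. ?Y i \<omega> * indicator {K..} (W T \<omega>))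
      = (t (Suc i) - t i) * expectation (\<lambda>\<omega>. \<xi> i \<omega> * gauss_kernel (T - t i) (W (t i) \<omega> - K))"
      using t_bounds[OF i] \<xi>_meas[OF i] \<xi>_bound[OF i]
      by (intro expectation_increment_terminal_indicator) auto
    ultimately have "has_bochner_integral M (\<lambda>\<omega>. ?Y i \<omega> * indicator {K..} (W T \<omega>) - p * ?Y i \<omega>)
      ((t (Suc i) - t i) * expectation (\<lambda>\<omega>. \<xi> i \<omega> * gauss_kernel (T - t i) (W (t i) \<omega> - K)))"
      using Y YI by (simp add: has_bochner_integral_iff)
    then show ?thesis by (simp add: centred_payoff_def p_def algebra_simps)
  qed
  have "has_bochner_integral M (\<lambda>\<omega>. \<Sum>i<n. ?Y i \<omega> * centred_payoff T K \<omega>)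
      (\<Sum>i<n. (t (Suc i) - t i) * expectation (\<lambda>\<omega>. \<xi> i \<omega> * gauss_kernel (T - t i) (W (t i) \<omega> - K)))"
    by (intro has_bochner_integral_sum summand) simp
  then have "has_bochner_integral M (\<lambda>\<omega>. simple_ito_integral W n t \<xi> \<omega> * centred_payoff T K \<omega>)
      (\<Sum>i<n. (t (Suc i) - t i) * expectation (\<lambda>\<omega>. \<xi> i \<omega> * gauss_kernel (T - t i) (W (t i) \<omega> - K)))"
    by (simp add: simple_ito_integral_def sum_distrib_right)
  then show "integrable M (\<lambda>\<omega>. simple_ito_integral W n t \<xi> \<omega> * centred_payoff T K \<omega>)"
    and "expectation (\<lambda>\<omega>. simple_ito_integral W n t \<xi> \<omega> * centred_payoff T K \<omega>)
      = (\<Sum>i<n. (t (Suc i) - t i)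
          * expectation (\<lambda>\<omega>. \<xi> i \<omega> * gauss_kernel (T - t i) (W (t i) \<omega> - K)))"
    by (auto simp: has_bochner_integral_iff)
qed

lemma simple_process_measurable:
  "(\<lambda>z. simple_process n t \<xi> (snd z) (fst z)) \<in> borel_measurable (M \<Otimes>\<^sub>M lborel)"
  unfolding simple_process_def
proof (intro borel_measurable_sum borel_measurable_times)
  fix i assume "i \<in> {..<n}"
  then have [measurable]: "\<xi> i \<in> borel_measurable M" using \<xi>_meas_M by simp
  show "(\<lambda>z. \<xi> i (fst z)) \<in> borel_measurable (M \<Otimes>\<^sub>M lborel)"
    "(\<lambda>z. indicat_real {t i<..t (Suc i)} (snd z)) \<in> borel_measurable (M \<Otimes>\<^sub>M lborel)"
    by measurable
qed

lemma simple_process_square_integral: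
  "has_bochner_integral (M \<Otimes>\<^sub>M lborel) (\<lambda>z. (simple_process n t \<xi> (snd z) (fst z))\<^sup>2)
    (\<Sum>i<n. (t (Suc i) - t i) * expectation (\<lambda>\<omega>. (\<xi> i \<omega>)\<^sup>2))"
proof -
  interpret P: pair_sigma_finite M lborel ..
  have "has_bochner_integral (M \<Otimes>\<^sub>M lborel)
      (\<lambda>z. \<Sum>i<n. (\<xi> i (fst z))\<^sup>2 * indicator {t i<..t (Suc i)} (snd z))
      (\<Sum>i<n. expectation (\<lambda>\<omega>. (\<xi> i \<omega>)\<^sup>2) * integral\<^sup>L lborel (indicat_real {t i<..t (Suc i)}))"
    by (intro has_bochner_integral_sum P.has_bochner_integral_product \<xi>_square_integrable
        integrable_indicator_interval) auto
  moreover have "integral\<^sup>L lborel (indicat_real {t i<..t (Suc i)}) = t (Suc i) - t i" if "i < n" for i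
    using t_less[OF that] by simp
  ultimately show ?thesis
    by (simp add: simple_process_square[of n t, OF t_less] mult.commute)
qed

text \<open>By the martingale property the expectation \<open>E (\<xi>\<^sub>i H\<^sub>s)\<close> is constant on the interval of
  \<open>\<xi>\<^sub>i\<close>, so integrating over \<open>s\<close> only multiplies it by the length. The resulting sum is the
  one in \<open>simple_ito_integral_times_payoff\<close>.\<close>

lemma simple_process_times_kernel:
  "has_bochner_integral (M \<Otimes>\<^sub>M lborel)
    (\<lambda>z. simple_process n t \<xi> (snd z) (fst z) * kernel_integrand T K z)
    (\<Sum>i<n. (t (Suc i) - t i)
      * expectation (\<lambda>\<omega>. \<xi> i \<omega> * gauss_kernel (T - t i) (W (t i) \<omega> - K)))"
proof -
  interpret P: pair_sigma_finite M lborel ..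
  note [measurable] = kernel_integrand_measurable[OF T, of K]
  have summand: "has_bochner_integral (M \<Otimes>\<^sub>M lborel)
      (\<lambda>z. \<xi> i (fst z) * indicator {t i<..t (Suc i)} (snd z) * kernel_integrand T K z)
      ((t (Suc i) - t i) * expectation (\<lambda>\<omega>. \<xi> i \<omega> * gauss_kernel (T - t i) (W (t i) \<omega> - K)))"
    if i: "i < n" for i
  proof -
    note ti = t_bounds[OF i]
    let ?J = "{t i<..t (Suc i)}"
    let ?e = "expectation (\<lambda>\<omega>. \<xi> i \<omega> * gauss_kernel (T - t i) (W (t i) \<omega> - K))"
    have [measurable]: "\<xi> i \<in> borel_measurable M" by (rule \<xi>_meas_M[OF i])
    have "(indicat_real ?J s)\<^sup>2 = indicator ?J s" for s by (simp split: split_indicator)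
    then have "integrable (M \<Otimes>\<^sub>M lborel) (\<lambda>z. (\<xi> i (fst z) * indicator ?J (snd z))\<^sup>2)"
      using P.has_bochner_integral_product[OF \<xi>_square_integrable[OF i]
          integrable_indicator_interval[of "t i" "t (Suc i)"]]
      by (simp add: has_bochner_integral_iff power_mult_distrib)
    then have int: "integrable (M \<Otimes>\<^sub>M lborel)
        (\<lambda>z. \<xi> i (fst z) * indicator ?J (snd z) * kernel_integrand T K z)"
      using kernel_integrand_square[OF T, of K]
      by (intro integrable_mult_square_integrable) (auto simp: has_bochner_integral_iff)
    have "integral\<^sup>L (M \<Otimes>\<^sub>M lborel) (\<lambda>z. \<xi> i (fst z) * indicator ?J (snd z) * kernel_integrand T K z)
        = (LBINT s. expectation (\<lambda>\<omega>. \<xi> i \<omega> * indicator ?J s * kernel_integrand T K (\<omega>, s)))"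
      using P.integral_snd[of "\<lambda>\<omega> s. \<xi> i \<omega> * indicator ?J s * kernel_integrand T K (\<omega>, s)"] int
      by (simp add: split_beta')
    also have "\<dots> = (LBINT s. ?e * indicator ?J s)"
    proof (rule integral_cong_AE)
      show "AE s in lborel. expectation (\<lambda>\<omega>. \<xi> i \<omega> * indicator ?J s * kernel_integrand T K (\<omega>, s))
          = ?e * indicator ?J s"
        using AE_lborel_singleton[of T]
      proof eventually_elim
        fix s assume "s \<noteq> T"
        show "expectation (\<lambda>\<omega>. \<xi> i \<omega> * indicator ?J s * kernel_integrand T K (\<omega>, s))
          = ?e * indicator ?J s"
        proof (cases "s \<in> ?J")
          case True
          with ti \<open>s \<noteq> T\<close> have s: "t i < s" "s < T" "0 \<le> s" by auto
          then have "expectation (\<lambda>\<omega>. \<xi> i \<omega> * gauss_kernel (T - s) (W s \<omega> - K)) = ?e"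
            using kernel_martingale[OF ti(1) s(1,2) \<xi>_meas[OF i] \<xi>_bound[OF i]] by blast
          then show ?thesis using True s by (simp add: kernel_integrand_def)
        qed simp
      qed
      have "(\<lambda>s. expectation (\<lambda>\<omega>. \<xi> i \<omega> * indicator ?J s * kernel_integrand T K (\<omega>, s)))
          \<in> borel_measurable lborel"
        by measurable
      then show "(\<lambda>s. expectation (\<lambda>\<omega>. \<xi> i \<omega> * indicator ?J s * kernel_integrand T K (\<omega>, s)))
          \<in> borel_measurable lborel" .
    qed measurable
    also have "\<dots> = (t (Suc i) - t i) * ?e" using ti by simp
    finally show ?thesis using int by (simp add: has_bochner_integral_iff)
  qed
  have "has_bochner_integral (M \<Otimes>\<^sub>M lborel)
      (\<lambda>z. \<Sum>i<n. \<xi> i (fst z) * indicator {t i<..t (Suc i)} (snd z) * kernel_integrand T K z)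
      (\<Sum>i<n. (t (Suc i) - t i) * expectation (\<lambda>\<omega>. \<xi> i \<omega> * gauss_kernel (T - t i) (W (t i) \<omega> - K)))"
    by (intro has_bochner_integral_sum summand) simp
  then show ?thesis unfolding simple_process_def sum_distrib_right .
qed

text \<open>Both squared distances are expanded, and their three terms agree one by one. The common
  value is kept explicit because it is evaluated for a particular \<open>\<phi>\<close> when \<open>H\<close> is approximated.\<close>

lemma simple_ito_error:
  defines "cross \<equiv> \<Sum>i<n. (t (Suc i) - t i)
      * expectation (\<lambda>\<omega>. \<xi> i \<omega> * gauss_kernel (T - t i) (W (t i) \<omega> - K))"
    and "energy \<equiv> \<Sum>i<n. (t (Suc i) - t i) * expectation (\<lambda>\<omega>. (\<xi> i \<omega>)\<^sup>2)"
    and "v \<equiv> gauss_cdf T (K - w0) * (1 - gauss_cdf T (K - w0))"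
  shows "(\<integral>\<^sup>+\<omega>. ennreal ((simple_ito_integral W n t \<xi> \<omega> - centred_payoff T K \<omega>)\<^sup>2) \<partial>M)
      = ennreal (energy - 2 * cross + v)"
    and "process_sq_norm M T
        (\<lambda>s \<omega>. simple_process n t \<xi> s \<omega> - gauss_kernel (T - s) (W s \<omega> - K))
      = ennreal (energy - 2 * cross + v)"
proof -
  interpret P: pair_sigma_finite M lborel ..
  note [measurable] = kernel_integrand_measurable[OF T, of K] simple_process_measurable
  let ?S = "simple_ito_integral W n t \<xi>" and ?X = "centred_payoff T K"
  let ?f = "\<lambda>z. simple_process n t \<xi> (snd z) (fst z)" and ?h = "kernel_integrand T K"
  have "has_bochner_integral M (\<lambda>\<omega>. (?S \<omega>)\<^sup>2 - 2 * (?S \<omega> * ?X \<omega>) + (?X \<omega>)\<^sup>2) (energy - 2 * cross + v)"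
    unfolding energy_def cross_def v_def
    by (intro has_bochner_integral_add has_bochner_integral_diff has_bochner_integral_mult_right)
       (use simple_ito_isometry[of n] simple_ito_integral_times_payoff centred_payoff_square[OF T]
         in \<open>auto simp: has_bochner_integral_iff\<close>)
  then have "has_bochner_integral M (\<lambda>\<omega>. (?S \<omega> - ?X \<omega>)\<^sup>2) (energy - 2 * cross + v)"
    by (simp add: power2_diff algebra_simps)
  then show "(\<integral>\<^sup>+\<omega>. ennreal ((?S \<omega> - ?X \<omega>)\<^sup>2) \<partial>M) = ennreal (energy - 2 * cross + v)"
    by (subst nn_integral_eq_integral) (auto simp: has_bochner_integral_iff)
  have "has_bochner_integral (M \<Otimes>\<^sub>M lborel)
      (\<lambda>z. (?f z)\<^sup>2 - 2 * (?f z * ?h z) + (?h z)\<^sup>2) (energy - 2 * cross + v)"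
    unfolding energy_def cross_def v_def
    by (intro has_bochner_integral_add has_bochner_integral_diff has_bochner_integral_mult_right
        simple_process_square_integral simple_process_times_kernel kernel_integrand_square T)
  then have int: "has_bochner_integral (M \<Otimes>\<^sub>M lborel) (\<lambda>z. (?f z - ?h z)\<^sup>2) (energy - 2 * cross + v)"
    by (simp add: power2_diff algebra_simps)
  have outside: "simple_process n t \<xi> s \<omega> = 0" if "s \<notin> {0..T}" for s \<omega>
    unfolding simple_process_def
  proof (rule sum.neutral, rule ballI)
    fix i assume "i \<in> {..<n}"
    then show "\<xi> i \<omega> * indicator {t i<..t (Suc i)} s = 0" using t_bounds[of i] that by auto
  qed
  have "process_sq_norm M T
        (\<lambda>s \<omega>. simple_process n t \<xi> s \<omega> - gauss_kernel (T - s) (W s \<omega> - K))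
      = (\<integral>\<^sup>+\<omega>. (\<integral>\<^sup>+s. ennreal ((?f (\<omega>, s) - ?h (\<omega>, s))\<^sup>2) \<partial>lborel) \<partial>M)"
    unfolding process_sq_norm_def
    by (intro nn_integral_cong) (auto simp: kernel_integrand_def outside indicator_def)
  also have "\<dots> = (\<integral>\<^sup>+z. ennreal ((?f z - ?h z)\<^sup>2) \<partial>(M \<Otimes>\<^sub>M lborel))"
    by (rule lborel.nn_integral_fst) measurable
  also have "\<dots> = ennreal (energy - 2 * cross + v)"
    using int by (subst nn_integral_eq_integral) (auto simp: has_bochner_integral_iff)
  finally show "process_sq_norm M T
        (\<lambda>s \<omega>. simple_process n t \<xi> s \<omega> - gauss_kernel (T - s) (W s \<omega> - K))
      = ennreal (energy - 2 * cross + v)" .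
qed

end

end

section \<open>The Ito integral of the kernel\<close>

context brownian_motion
begin

lemma simple_ito_error_eq:
  assumes T: "0 < T" and simple: "simple_process_data M F T n t \<xi>"
  shows "(\<integral>\<^sup>+\<omega>. ennreal ((simple_ito_integral W n t \<xi> \<omega> - centred_payoff T K \<omega>)\<^sup>2) \<partial>M)
    = process_sq_norm M T (\<lambda>s \<omega>. simple_process n t \<xi> s \<omega> - gauss_kernel (T - s) (W s \<omega> - K))"
proof -
  from simple obtain C where "t 0 = 0" "t n = T" "\<And>i. i < n \<Longrightarrow> t i < t (Suc i)"
    "\<And>i. i < n \<Longrightarrow> \<xi> i \<in> borel_measurable (F (t i))"
    "\<And>i \<omega>. i < n \<Longrightarrow> \<omega> \<in> space M \<Longrightarrow> \<bar>\<xi> i \<omega>\<bar> \<le> C"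
    unfolding simple_process_data_def by blast
  from simple_ito_error[OF T this, of K] show ?thesis by simp
qed

text \<open>For the left samples of \<open>H\<close> the cross term and the energy of \<open>simple_ito_error\<close> coincide, both
  being a left Riemann sum of \<open>kernel_energy\<close>. The samples are bounded because the last
  sampling time stays one mesh width away from \<open>T\<close>.\<close>

lemma kernel_left_sampling:
  fixes T K :: real and t :: "nat \<Rightarrow> nat \<Rightarrow> real" and \<xi> :: "nat \<Rightarrow> nat \<Rightarrow> 'a \<Rightarrow> real"
  assumes T: "0 < T"
    and t_def: "t = (\<lambda>k i. real i * T / real (Suc k))"
    and \<xi>_def: "\<xi> = (\<lambda>k i \<omega>. gauss_kernel (T - t k i) (W (t k i) \<omega> - K))"
  shows "simple_process_data M F T (Suc k) (t k) (\<xi> k)"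
    and "(\<lambda>k. process_sq_norm M T (\<lambda>s \<omega>. simple_process (Suc k) (t k) (\<xi> k) s \<omega>
          - gauss_kernel (T - s) (W s \<omega> - K))) \<longlonglongrightarrow> 0"
proof -
  have t: "t k 0 = 0" "t k (Suc k) = T" for k using T by (auto simp: t_def)
  have t_less: "t k i < t k (Suc i)" for k i
    using T by (simp add: t_def divide_strict_right_mono)
  have t_nonneg: "0 \<le> t k i" for k i using T by (simp add: t_def)
  have step: "T / real (Suc k) \<le> T - t k i" if "i < Suc k" for k i
  proof -
    have "t k (Suc i) \<le> t k (Suc k)" using that T unfolding t_def by (intro divide_right_mono mult_right_mono) auto
    moreover have "t k (Suc i) = t k i + T / real (Suc k)"
      by (simp add: t_def add_divide_distrib ring_distribs)
    ultimately show ?thesis using t by simp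
  qed
  have pos: "0 < T - t k i" if "i < Suc k" for k i
    using step[OF that] T by (smt (verit) divide_pos_pos of_nat_0_less_iff zero_less_Suc)
  have meas: "\<xi> k i \<in> borel_measurable (F (t k i))" for k i
    unfolding \<xi>_def using adapted[OF t_nonneg, of k i] by measurable
  have bound: "\<bar>\<xi> k i \<omega>\<bar> \<le> 1 / sqrt (2 * pi * (T / real (Suc k)))" if "i < Suc k" for k i \<omega>
  proof -
    have "\<bar>\<xi> k i \<omega>\<bar> \<le> 1 / sqrt (2 * pi * (T - t k i))"
      unfolding \<xi>_def using gauss_kernel_le[OF pos[OF that]] pos[OF that] by simp
    also have "\<dots> \<le> 1 / sqrt (2 * pi * (T / real (Suc k)))"
      using step[OF that] pos[OF that] T by (intro divide_left_mono real_sqrt_le_mono mult_left_mono mult_pos_pos) auto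
    finally show ?thesis .
  qed
  show "simple_process_data M F T (Suc k) (t k) (\<xi> k)" for k
    unfolding simple_process_data_def using t t_less meas bound by blast
  define q where "q = kernel_energy T (K - w0)"
  define v where "v = gauss_cdf T (K - w0) * (1 - gauss_cdf T (K - w0))"
  have "process_sq_norm M T (\<lambda>s \<omega>. simple_process (Suc k) (t k) (\<xi> k) s \<omega>
          - gauss_kernel (T - s) (W s \<omega> - K))
      = ennreal (v - (\<Sum>i<Suc k. q (t k i) * (T / real (Suc k))))" for k
  proof -
    have E: "expectation (\<lambda>\<omega>. (\<xi> k i \<omega>)\<^sup>2) = q (t k i)" if "i < Suc k" for i
      unfolding \<xi>_def q_def using pos[OF that] by (intro expectation_kernel_square t_nonneg) simp
    have eq: "\<xi> k i \<omega> * gauss_kernel (T - t k i) (W (t k i) \<omega> - K) = (\<xi> k i \<omega>)\<^sup>2" for i \<omega>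
      by (simp add: \<xi>_def power2_eq_square)
    have sum: "(\<Sum>i<Suc k. (t k (Suc i) - t k i) * expectation (\<lambda>\<omega>. (\<xi> k i \<omega>)\<^sup>2))
        = (\<Sum>i<Suc k. q (t k i) * (T / real (Suc k)))"
    proof (rule sum.cong[OF refl])
      fix i assume "i \<in> {..<Suc k}"
      moreover have "t k (Suc i) - t k i = T / real (Suc k)"
        by (simp add: t_def add_divide_distrib ring_distribs)
      ultimately show "(t k (Suc i) - t k i) * expectation (\<lambda>\<omega>. (\<xi> k i \<omega>)\<^sup>2) = q (t k i) * (T / real (Suc k))"
        using E[of i] by simp
    qed
    have "x - 2 * x + v = v - x" for x by simp
    then show ?thesis
      using simple_ito_error(2)[OF T t t_less meas bound, of k K]
      unfolding eq sum v_def[symmetric] by (simp only:)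
  qed
  moreover have "(\<lambda>k. v - (\<Sum>i<Suc k. q (t k i) * (T / real (Suc k)))) \<longlonglongrightarrow> 0"
  proof -
    have "has_bochner_integral lborel (\<lambda>s. indicator {0..T} s * q s) v"
    proof (rule has_bochner_integral_nn_integral)
      show "(\<integral>\<^sup>+s. ennreal (indicator {0..T} s * q s) \<partial>lborel) = ennreal v"
        using nn_integral_kernel_energy[OF T, of "K - w0"]
        unfolding q_def v_def nn_integral_set_ennreal by (simp only: mult.commute)
      show "0 \<le> v" unfolding v_def centred_payoff_square(2)[OF T, symmetric] by simp
    qed (auto simp: q_def kernel_energy_nonneg indicator_def)
    then have "(\<lambda>n. \<Sum>i<n. q (real i * T / real n) * (T / real n)) \<longlonglongrightarrow> v"
      using left_riemann_sums_tendsto[of T q] T kernel_energy_nonneg kernel_energy_mono isCont_kernel_energy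
      by (simp add: q_def has_bochner_integral_iff)
    from LIMSEQ_Suc[OF this]
    have "(\<lambda>k. \<Sum>i<Suc k. q (t k i) * (T / real (Suc k))) \<longlonglongrightarrow> v"
      unfolding t_def .
    from tendsto_diff[OF tendsto_const[of v] this] show ?thesis by simp
  qed
  ultimately show "(\<lambda>k. process_sq_norm M T (\<lambda>s \<omega>. simple_process (Suc k) (t k) (\<xi> k) s \<omega>
          - gauss_kernel (T - s) (W s \<omega> - K))) \<longlonglongrightarrow> 0"
    using tendsto_ennrealI by fastforce
qed

lemma process_sq_norm_kernel_finite:
  assumes T: "0 < T"
  shows "process_sq_norm M T (\<lambda>s \<omega>. gauss_kernel (T - s) (W s \<omega> - K)) < \<infinity>"
proof -
  note [measurable] = kernel_integrand_measurable[OF T, of K]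
  have "process_sq_norm M T (\<lambda>s \<omega>. gauss_kernel (T - s) (W s \<omega> - K))
      = (\<integral>\<^sup>+\<omega>. (\<integral>\<^sup>+s. ennreal ((kernel_integrand T K (\<omega>, s))\<^sup>2) \<partial>lborel) \<partial>M)"
    unfolding process_sq_norm_def
    by (intro nn_integral_cong) (auto simp: kernel_integrand_def indicator_def)
  also have "\<dots> = (\<integral>\<^sup>+z. ennreal ((kernel_integrand T K z)\<^sup>2) \<partial>(M \<Otimes>\<^sub>M lborel))"
    by (rule lborel.nn_integral_fst) measurable
  also have "\<dots> < \<infinity>"
    using kernel_integrand_square[OF T, of K]
    by (subst nn_integral_eq_integral) (auto simp: has_bochner_integral_iff)
  finally show ?thesis .
qed

lemma centred_payoff_has_ito_integral:
  assumes T: "0 < T"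
  shows "has_ito_integral M F W T (\<lambda>s \<omega>. gauss_kernel (T - s) (W s \<omega> - K)) (centred_payoff T K)"
proof -
  define t where "t = (\<lambda>k i. real i * T / real (Suc k))"
  define \<xi> where "\<xi> = (\<lambda>k i \<omega>. gauss_kernel (T - t k i) (W (t k i) \<omega> - K))"
  note sampling = kernel_left_sampling[OF T t_def \<xi>_def]
  show ?thesis
    unfolding has_ito_integral_def
  proof (intro conjI exI[of _ Suc] exI[of _ t] exI[of _ \<xi>] allI)
    show "(\<lambda>k. \<integral>\<^sup>+\<omega>. ennreal ((simple_ito_integral W (Suc k) (t k) (\<xi> k) \<omega>
        - centred_payoff T K \<omega>)\<^sup>2) \<partial>M) \<longlonglongrightarrow> 0"
      unfolding simple_ito_error_eq[OF T sampling(1)] by (rule sampling(2))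
  qed (use T sampling progressively_measurable_kernel process_sq_norm_kernel_finite in auto)
qed

text \<open>The simple integrals that approximate \<open>I\<close> also approximate the centred payoff, by
  \<open>simple_ito_error_eq\<close>, and \<open>L\<^sup>2\<close> limits are almost surely unique. In particular no
  comparison of simple processes over different partitions is needed.\<close>

lemma has_ito_integral_kernel_unique:
  assumes T: "0 < T"
    and I: "has_ito_integral M F W T (\<lambda>s \<omega>. gauss_kernel (T - s) (W s \<omega> - K)) I"
  shows "AE \<omega> in M. I \<omega> = centred_payoff T K \<omega>"
proof -
  let ?X = "centred_payoff T K"
  from I obtain n t \<xi> where simple: "\<And>k. simple_process_data M F T (n k) (t k) (\<xi> k)"
    and approx: "(\<lambda>k. process_sq_norm M T (\<lambda>s \<omega>. simple_process (n k) (t k) (\<xi> k) s \<omega>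
        - gauss_kernel (T - s) (W s \<omega> - K))) \<longlonglongrightarrow> 0"
    and lim: "(\<lambda>k. \<integral>\<^sup>+\<omega>. ennreal ((simple_ito_integral W (n k) (t k) (\<xi> k) \<omega> - I \<omega>)\<^sup>2) \<partial>M) \<longlonglongrightarrow> 0"
    and [measurable]: "I \<in> borel_measurable M"
    unfolding has_ito_integral_def by blast
  define S where "S k = simple_ito_integral W (n k) (t k) (\<xi> k)" for k
  have [measurable]: "?X \<in> borel_measurable M" using T by simp
  have [measurable]: "S k \<in> borel_measurable M" for k
  proof -
    have "0 \<le> t k i \<and> t k i \<le> T" if "i \<le> n k" for i
      using simple[of k] partition_mono[of "n k" "t k" 0 i] partition_mono[of "n k" "t k" i "n k"] that
      unfolding simple_process_data_def by auto
    then have "\<xi> k i \<in> borel_measurable M \<and> W (t k i) \<in> borel_measurable M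
        \<and> W (t k (Suc i)) \<in> borel_measurable M" if "i < n k" for i
      using simple[of k] that measurable_filtration_M[of "\<xi> k i" "t k i"]
      unfolding simple_process_data_def by simp
    then show ?thesis unfolding S_def simple_ito_integral_def[abs_def]
      by (intro borel_measurable_sum borel_measurable_times borel_measurable_diff) auto
  qed
  have lim_X: "(\<lambda>k. \<integral>\<^sup>+\<omega>. ennreal ((S k \<omega> - ?X \<omega>)\<^sup>2) \<partial>M) \<longlonglongrightarrow> 0"
    unfolding S_def simple_ito_error_eq[OF T simple] by (rule approx)
  have "(\<integral>\<^sup>+\<omega>. ennreal ((I \<omega> - ?X \<omega>)\<^sup>2) \<partial>M) \<le> 0"
  proof (rule tendsto_lowerbound)
    have "(\<lambda>k. 2 * ((\<integral>\<^sup>+\<omega>. ennreal ((S k \<omega> - I \<omega>)\<^sup>2) \<partial>M) + (\<integral>\<^sup>+\<omega>. ennreal ((S k \<omega> - ?X \<omega>)\<^sup>2) \<partial>M)))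
        \<longlonglongrightarrow> 2 * (0 + 0)"
      using lim lim_X unfolding S_def[symmetric]
      by (intro ennreal_tendsto_cmult tendsto_add) auto
    then show "(\<lambda>k. 2 * ((\<integral>\<^sup>+\<omega>. ennreal ((S k \<omega> - I \<omega>)\<^sup>2) \<partial>M) + (\<integral>\<^sup>+\<omega>. ennreal ((S k \<omega> - ?X \<omega>)\<^sup>2) \<partial>M)))
        \<longlonglongrightarrow> 0" by simp
    have "(\<integral>\<^sup>+\<omega>. ennreal ((I \<omega> - ?X \<omega>)\<^sup>2) \<partial>M)
        \<le> 2 * ((\<integral>\<^sup>+\<omega>. ennreal ((S k \<omega> - I \<omega>)\<^sup>2) \<partial>M) + (\<integral>\<^sup>+\<omega>. ennreal ((S k \<omega> - ?X \<omega>)\<^sup>2) \<partial>M))" for k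
    proof -
      have "(a - b)\<^sup>2 \<le> 2 * ((c - a)\<^sup>2 + (c - b)\<^sup>2)" for a b c :: real
        using zero_le_power2[of "a + b - 2 * c"] by (simp add: power2_eq_square algebra_simps)
      then have "(\<integral>\<^sup>+\<omega>. ennreal ((I \<omega> - ?X \<omega>)\<^sup>2) \<partial>M)
          \<le> (\<integral>\<^sup>+\<omega>. 2 * (ennreal ((S k \<omega> - I \<omega>)\<^sup>2) + ennreal ((S k \<omega> - ?X \<omega>)\<^sup>2)) \<partial>M)"
        by (intro nn_integral_mono) (auto simp flip: ennreal_plus ennreal_mult' ennreal_numeral intro!: ennreal_leI)
      also have "\<dots> = 2 * ((\<integral>\<^sup>+\<omega>. ennreal ((S k \<omega> - I \<omega>)\<^sup>2) \<partial>M) + (\<integral>\<^sup>+\<omega>. ennreal ((S k \<omega> - ?X \<omega>)\<^sup>2) \<partial>M))"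
        by (simp add: nn_integral_cmult nn_integral_add)
      finally show ?thesis .
    qed
    then show "\<forall>\<^sub>F k in sequentially. (\<integral>\<^sup>+\<omega>. ennreal ((I \<omega> - ?X \<omega>)\<^sup>2) \<partial>M)
        \<le> 2 * ((\<integral>\<^sup>+\<omega>. ennreal ((S k \<omega> - I \<omega>)\<^sup>2) \<partial>M) + (\<integral>\<^sup>+\<omega>. ennreal ((S k \<omega> - ?X \<omega>)\<^sup>2) \<partial>M))"
      by simp
  qed simp
  then have "AE \<omega> in M. ennreal ((I \<omega> - ?X \<omega>)\<^sup>2) = 0"
    by (subst nn_integral_0_iff_AE[symmetric]) auto
  then show ?thesis by eventually_elim (simp add: ennreal_eq_0_iff)
qed

end

theorem proposition3p1:
  fixes M :: "'a measure" and F :: "real \<Rightarrow> 'a measure" and W :: "real \<Rightarrow> 'a \<Rightarrow> real"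
    and w0 T K :: real
  assumes "T > 0"
    and "F = augmented_filtration M W"
    and "brownian_motion M F W w0"
  shows "AE \<omega> in M. indicat_real {K..} (W T \<omega>) =
      measure M {\<omega> \<in> space M. W T \<omega> > K}
      + ito_integral M F W T (\<lambda>s \<omega>. gauss_kernel (T - s) (W s \<omega> - K)) \<omega>"
proof -
  interpret brownian_motion M F W w0 by (rule assms(3))
  let ?H = "\<lambda>s \<omega>. gauss_kernel (T - s) (W s \<omega> - K)"
  have ex: "\<exists>I. has_ito_integral M F W T ?H I"
    using centred_payoff_has_ito_integral[OF assms(1)] by blast
  then have "has_ito_integral M F W T ?H (ito_integral M F W T ?H)"
    unfolding ito_integral_def by (simp add: someI_ex)
  from has_ito_integral_kernel_unique[OF assms(1) this] show ?thesis
    by eventually_elim (simp add: centred_payoff_def)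
qed

end
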